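(* Let $f:\mathbf{SU}(2)\to\mathbb R$ be a smooth function. For $t>0$ and $g\in\mathbf{SU}(2)$, $$\Gamma(P_tf,P_tf)(g)\le A(t)\left(\int_{\mathbf{SU}(2)}f^2\,d\mu-\left(\int_{\mathbf{SU}(2)}f\,d\mu\right)^2\right),$$ where $$A(t)=-\frac14\frac{\partial}{\partial t}\int_{\mathbf{SU}(2)}p_t^2\,d\mu .$$
   Context: $\mathbf{SU}(2)$ is the group of $2\times2$ complex unitary matrices of determinant $1$. Let $X,Y,Z$ be the left-invariant vector fields on $\mathbf{SU}(2)$ corresponding to the elements $\begin{pmatrix}0&1\\-1&0\end{pmatrix}$, $\begin{pmatrix}0&i\\i&0\end{pmatrix}$, $\begin{pmatrix}i&0\\0&-i\end{pmatrix}$ of its Lie algebra; they satisfy $[Z,X]=2Y$, $[X,Y]=2Z$, $[Y,Z]=2X$. Put $\mathcal L=X^2+Y^2$ (a subelliptic operator). $\mu$ is the normalized bi-invariant Haar (probability) measure. $P_t=e^{t\mathcal L}$ is the heat semigroup and $p_t$ its smooth heat kernel issued from the identity, with respect to $\mu$: $(P_tf)(\text{identity})=\int p_tf\,d\mu$. For smooth $h$, $\Gamma(h,h)=(Xh)^2+(Yh)^2$. *)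

theory Defs
  imports "HOL-Probability.Probability"
begin

type_synonym cmat2 = "complex^2^2"

definition conj_transpose :: "cmat2 \<Rightarrow> cmat2" where
  "conj_transpose A = (\<chi> i j. cnj (A $ j $ i))"

definition SU2 :: "cmat2 set" where
  "SU2 = {A. conj_transpose A ** A = mat 1 \<and> det A = 1}"

text \<open>
  Functions on the group are represented by functions on all of \<^typ>\<open>cmat2\<close>; only their
  values on \<^const>\<open>SU2\<close> ever matter.  Smoothness is that of a function on a subset of a
  Euclidean space: near each point of the subset it agrees with a function that is
  infinitely differentiable on an open set of the ambient space.
\<close>

primrec Ck_on :: "nat \<Rightarrow> ('a::euclidean_space \<Rightarrow> real) \<Rightarrow> 'a set \<Rightarrow> bool" where
  "Ck_on 0 F U \<longleftrightarrow> continuous_on U F"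
| "Ck_on (Suc k) F U \<longleftrightarrow>
     (\<forall>x\<in>U. F differentiable (at x)) \<and>
     (\<forall>v. Ck_on k (\<lambda>x. frechet_derivative F (at x) v) U)"

definition smooth_on_SU2 :: "(cmat2 \<Rightarrow> real) \<Rightarrow> bool" where
  "smooth_on_SU2 f \<longleftrightarrow>
     (\<forall>g\<in>SU2. \<exists>U F. open U \<and> g \<in> U \<and> (\<forall>k. Ck_on k F U) \<and> (\<forall>h\<in>U \<inter> SU2. F h = f h))"

definition matrix_exp :: "cmat2 \<Rightarrow> cmat2" where
  "matrix_exp A = (\<Sum>n. (1 / fact n) *\<^sub>R ((\<lambda>B. A ** B) ^^ n) (mat 1))"

definition left_inv_field :: "cmat2 \<Rightarrow> (cmat2 \<Rightarrow> real) \<Rightarrow> cmat2 \<Rightarrow> real" where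
  "left_inv_field E f g = deriv (\<lambda>s. f (g ** matrix_exp (s *\<^sub>R E))) 0"

definition field_X :: "(cmat2 \<Rightarrow> real) \<Rightarrow> cmat2 \<Rightarrow> real" where
  "field_X = left_inv_field (vector [vector [0, 1], vector [-1, 0]])"

definition field_Y :: "(cmat2 \<Rightarrow> real) \<Rightarrow> cmat2 \<Rightarrow> real" where
  "field_Y = left_inv_field (vector [vector [0, \<i>], vector [\<i>, 0]])"

definition sublaplacian :: "(cmat2 \<Rightarrow> real) \<Rightarrow> cmat2 \<Rightarrow> real" where
  "sublaplacian f g = field_X (field_X f) g + field_Y (field_Y f) g"

definition carre_du_champ :: "(cmat2 \<Rightarrow> real) \<Rightarrow> (cmat2 \<Rightarrow> real) \<Rightarrow> cmat2 \<Rightarrow> real" where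
  "carre_du_champ f h g = field_X f g * field_X h g + field_Y f g * field_Y h g"

definition haar_probability :: "cmat2 measure \<Rightarrow> bool" where
  "haar_probability \<mu> \<longleftrightarrow>
     prob_space \<mu> \<and> sets \<mu> = sets (restrict_space borel SU2) \<and>
     (\<forall>g\<in>SU2. distr \<mu> \<mu> (\<lambda>h. g ** h) = \<mu> \<and> distr \<mu> \<mu> (\<lambda>h. h ** g) = \<mu>)"

text \<open>
  Strongly continuous semigroups of bounded linear operators on the Banach space of
  continuous functions on \<^const>\<open>SU2\<close> with the supremum norm.  Linearity and the norm bound
  force the values of \<open>P t f\<close> on \<^const>\<open>SU2\<close> to depend only on those of \<open>f\<close>.
\<close>

definition C0_semigroup :: "(real \<Rightarrow> (cmat2 \<Rightarrow> real) \<Rightarrow> cmat2 \<Rightarrow> real) \<Rightarrow> bool" where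
  "C0_semigroup P \<longleftrightarrow>
     (\<forall>t\<ge>0. \<forall>f. continuous_on SU2 f \<longrightarrow> continuous_on SU2 (P t f)) \<and>
     (\<forall>t\<ge>0. \<forall>f h a b. continuous_on SU2 f \<longrightarrow> continuous_on SU2 h \<longrightarrow>
        (\<forall>g\<in>SU2. P t (\<lambda>x. a * f x + b * h x) g = a * P t f g + b * P t h g)) \<and>
     (\<forall>t\<ge>0. \<exists>C. \<forall>f B. continuous_on SU2 f \<longrightarrow> (\<forall>g\<in>SU2. \<bar>f g\<bar> \<le> B) \<longrightarrow>
        (\<forall>g\<in>SU2. \<bar>P t f g\<bar> \<le> C * B)) \<and>
     (\<forall>f. continuous_on SU2 f \<longrightarrow> (\<forall>g\<in>SU2. P 0 f g = f g)) \<and>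
     (\<forall>s\<ge>0. \<forall>t\<ge>0. \<forall>f. continuous_on SU2 f \<longrightarrow> (\<forall>g\<in>SU2. P (s + t) f g = P s (P t f) g)) \<and>
     (\<forall>t\<ge>0. \<forall>f. continuous_on SU2 f \<longrightarrow>
        uniform_limit SU2 (\<lambda>s. P s f) (P t f) (at t within {0..}))"

definition generator_graph ::
    "(real \<Rightarrow> (cmat2 \<Rightarrow> real) \<Rightarrow> cmat2 \<Rightarrow> real) \<Rightarrow> (cmat2 \<Rightarrow> real) \<Rightarrow> (cmat2 \<Rightarrow> real) \<Rightarrow> bool" where
  "generator_graph P f h \<longleftrightarrow> continuous_on SU2 f \<and> continuous_on SU2 h \<and>
     uniform_limit SU2 (\<lambda>t g. (P t f g - f g) / t) h (at_right 0)"

definition sublaplacian_closure_graph :: "(cmat2 \<Rightarrow> real) \<Rightarrow> (cmat2 \<Rightarrow> real) \<Rightarrow> bool" where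
  "sublaplacian_closure_graph f h \<longleftrightarrow>
     (\<exists>\<phi>. (\<forall>n::nat. smooth_on_SU2 (\<phi> n)) \<and>
          uniform_limit SU2 \<phi> f sequentially \<and>
          uniform_limit SU2 (\<lambda>n. sublaplacian (\<phi> n)) h sequentially)"

text \<open>
  \<open>P t\<close> is the operator \<open>exp (t L)\<close> with \<open>L\<close> the \<^const>\<open>sublaplacian\<close>, that is, \<open>P\<close> is the
  semigroup generated by (the closure of) \<open>L\<close>.  This determines \<open>P t f\<close> uniquely on
  \<^const>\<open>SU2\<close> for every \<open>t \<ge> 0\<close> and every continuous \<open>f\<close>.
\<close>

definition heat_semigroup :: "(real \<Rightarrow> (cmat2 \<Rightarrow> real) \<Rightarrow> cmat2 \<Rightarrow> real) \<Rightarrow> bool" where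
  "heat_semigroup P \<longleftrightarrow>
     C0_semigroup P \<and> (\<forall>f h. generator_graph P f h \<longleftrightarrow> sublaplacian_closure_graph f h)"

definition heat_kernel ::
    "cmat2 measure \<Rightarrow> (real \<Rightarrow> (cmat2 \<Rightarrow> real) \<Rightarrow> cmat2 \<Rightarrow> real) \<Rightarrow> (real \<Rightarrow> cmat2 \<Rightarrow> real) \<Rightarrow> bool" where
  "heat_kernel \<mu> P p \<longleftrightarrow>
     (\<forall>t>0. smooth_on_SU2 (p t) \<and>
       (\<forall>f. continuous_on SU2 f \<longrightarrow> P t f (mat 1) = (\<integral>h. p t h * f h \<partial>\<mu>)))"

definition A_const :: "cmat2 measure \<Rightarrow> (real \<Rightarrow> cmat2 \<Rightarrow> real) \<Rightarrow> real \<Rightarrow> real" where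
  "A_const \<mu> p t = - (1 / 4) * deriv (\<lambda>s. \<integral>h. (p s h)\<^sup>2 \<partial>\<mu>) t"

end

theory Submission
  imports Defs
begin

text \<open>
  Write \<open>P\<^sub>t f(g) = \<integral> p\<^sub>t(h) f(g h) dh\<close>; this formula expresses that \<open>P\<^sub>t\<close> commutes with left
  translations.  Moving a right factor \<open>exp (s E)\<close> of \<open>g\<close> onto the kernel by a change of variables,
  and using \<open>p\<^sub>t(h\<^sup>-\<^sup>1) = p\<^sub>t(h)\<close>, one may differentiate the smooth kernel instead of \<open>f\<close>:
  \<open>E P\<^sub>t f(g) = \<integral> (E p\<^sub>t)(h\<^sup>-\<^sup>1) (f(g h) - m) dh\<close> for every constant \<open>m\<close>, because \<open>E p\<^sub>t\<close> has mean zero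
  (\<open>field_P_eq\<close>).  Take for \<open>m\<close> the mean of \<open>f\<close>.  Conjugation by
  \<open>diag (e\<^bsup>i\<pi>/4\<^esup>, e\<^bsup>-i\<pi>/4\<^esup>)\<close> turns \<open>X\<close> into \<open>Y\<close> and \<open>Y\<close> into \<open>-X\<close> and leaves \<open>p\<^sub>t\<close> invariant, so \<open>X p\<^sub>t\<close> and \<open>Y p\<^sub>t\<close>
  are orthogonal in \<open>L\<^sup>2\<close> and have the same norm, whose square \<open>M\<close> is half the energy \<open>\<integral> \<Gamma>(p\<^sub>t, p\<^sub>t)\<close>
  (\<open>field_p_second_moments\<close>).  The Cauchy-Schwarz inequality then bounds \<open>(X P\<^sub>t f)\<^sup>2 + (Y P\<^sub>t f)\<^sup>2\<close> by \<open>M\<close> times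
  the variance of \<open>f\<close>.  Finally \<open>d/dt \<integral> p\<^sub>t\<^sup>2 = 2 \<integral> p\<^sub>t L p\<^sub>t = -2 \<integral> \<Gamma>(p\<^sub>t, p\<^sub>t)\<close>, so that
  \<open>M = A(t)\<close> (\<open>A_const_eq_energy\<close>).

  The semigroup is given only through its generator, the closure of \<open>L\<close>, so its symmetries have to be
  derived.  The tool is the function \<open>s \<mapsto> \<integral> (P\<^sub>s f)(T x) (P\<^bsub>t-s\<^esub> k)(x) dx\<close> for a map \<open>T\<close> that commutes
  with \<open>L\<close>: its derivative vanishes because \<open>L\<close> is symmetric, and comparing \<open>s = 0\<close> with \<open>s = t\<close> gives
  both the symmetry of \<open>P\<^sub>t\<close> in \<open>L\<^sup>2\<close> (\<open>T\<close> the identity) and the commutation of \<open>P\<^sub>t\<close> with \<open>T\<close>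
  (\<open>P_symmetric\<close>, \<open>P_commute_symmetry\<close>).  Left translations and the conjugation above are such
  maps.  The invariance of the kernel under inversion and the identity \<open>p\<^bsub>t+s\<^esub> = P\<^sub>s p\<^sub>t\<close> follow by
  testing against smooth functions, and the latter makes \<open>p\<^sub>t\<close> differentiable in \<open>t\<close>.
\<close>

section \<open>The group of special unitary matrices\<close>

lemma matrix_mult_scaleR_left: "(c *\<^sub>R A) ** B = c *\<^sub>R (A ** B)" for A B :: cmat2
  by (simp add: matrix_matrix_mult_def vec_eq_iff scaleR_sum_right)

lemma matrix_mult_scaleR_right: "A ** (c *\<^sub>R B) = c *\<^sub>R (A ** B)" for A B :: cmat2
  by (simp add: matrix_matrix_mult_def vec_eq_iff scaleR_sum_right)

lemma matrix_mult_add_left: "(A + B) ** C = A ** C + B ** C" for A B C :: cmat2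
  by (simp add: matrix_matrix_mult_def vec_eq_iff sum.distrib distrib_right)

lemma linear_matrix_mult_left: "linear (\<lambda>x :: cmat2. a ** x)" for a :: cmat2
  by (rule linearI) (simp_all add: matrix_add_ldistrib matrix_mult_scaleR_right)

lemma linear_matrix_mult_right: "linear (\<lambda>x :: cmat2. x ** a)" for a :: cmat2
  by (rule linearI) (simp_all add: matrix_mult_add_left matrix_mult_scaleR_left)

lemma linear_conjugation: "linear (\<lambda>x :: cmat2. a ** x ** b)" for a b :: cmat2
  using linear_compose[OF linear_matrix_mult_left[of a] linear_matrix_mult_right[of b]]
  by (simp add: o_def)

lemma conj_transpose_mult: "conj_transpose (A ** B) = conj_transpose B ** conj_transpose A"
  by (simp add: conj_transpose_def matrix_matrix_mult_def vec_eq_iff mult.commute)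

lemma conj_transpose_conj_transpose [simp]: "conj_transpose (conj_transpose A) = A"
  by (simp add: conj_transpose_def vec_eq_iff)

lemma conj_transpose_one [simp]: "conj_transpose (mat 1) = mat 1"
  by (simp add: conj_transpose_def mat_def vec_eq_iff)

lemma det_conj_transpose: "det (conj_transpose A) = cnj (det A)"
  by (simp add: det_2 conj_transpose_def)

lemma SU2_one [simp]: "mat 1 \<in> SU2"
  by (simp add: SU2_def)

lemma SU2_inverse_left [simp]: "A \<in> SU2 \<Longrightarrow> conj_transpose A ** A = mat 1"
  by (simp add: SU2_def)

lemma SU2_inverse_right [simp]: "A \<in> SU2 \<Longrightarrow> A ** conj_transpose A = mat 1"
  by (simp add: SU2_def matrix_left_right_inverse)

lemma SU2_cancel_left: "A \<in> SU2 \<Longrightarrow> conj_transpose A ** (A ** B) = B"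
  by (simp add: matrix_mul_assoc)

lemma SU2_conj_transpose [simp]: "A \<in> SU2 \<Longrightarrow> conj_transpose A \<in> SU2"
  using SU2_inverse_right[of A] unfolding SU2_def
  by (simp add: det_conj_transpose del: SU2_inverse_right)

lemma SU2_mult [simp]: 
  assumes "A \<in> SU2" "B \<in> SU2" shows "A ** B \<in> SU2"
proof -
  have "conj_transpose (A ** B) ** (A ** B) = conj_transpose B ** (conj_transpose A ** (A ** B))"
    by (simp add: conj_transpose_mult matrix_mul_assoc)
  also have "\<dots> = mat 1"
    unfolding SU2_cancel_left[OF assms(1)] by (rule SU2_inverse_left[OF assms(2)])
  finally have "conj_transpose (A ** B) ** (A ** B) = mat 1" .
  moreover have "det (A ** B) = 1"
    using assms unfolding SU2_def mem_Collect_eq by (metis det_mul mult_1)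
  ultimately show ?thesis unfolding SU2_def mem_Collect_eq by (rule conjI)
qed

lemma continuous_on_linear:
  "linear L \<Longrightarrow> continuous_on S L" for L :: "'a::euclidean_space \<Rightarrow> 'b::real_normed_vector"
  by (simp add: linear_continuous_on linear_conv_bounded_linear)

lemma continuous_on_matrix_mult [continuous_intros]:
  fixes u v :: "'a::topological_space \<Rightarrow> cmat2"
  assumes "continuous_on S u" "continuous_on S v"
  shows "continuous_on S (\<lambda>x. u x ** v x)"
  unfolding matrix_matrix_mult_def using assms by (intro continuous_intros)

lemma continuous_on_conj_transpose [continuous_intros]:
  fixes u :: "'a::topological_space \<Rightarrow> cmat2"
  assumes "continuous_on S u"
  shows "continuous_on S (\<lambda>x. conj_transpose (u x))"
  unfolding conj_transpose_def using assms by (intro continuous_intros)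

lemma compact_SU2: "compact SU2"
proof -
  have "closed SU2"
  proof -
    have "closed {A :: cmat2. conj_transpose A ** A = mat 1}"
      by (intro closed_Collect_eq continuous_intros continuous_on_id)
    moreover have "closed {A :: cmat2. det A = 1}"
      unfolding det_2 by (intro closed_Collect_eq continuous_intros continuous_on_id)
    ultimately show ?thesis
      unfolding SU2_def by (simp add: Collect_conj_eq closed_Int)
  qed
  moreover have "bounded SU2"
  proof -
    have *: "cmod (A $ i $ j) \<le> 1" if A: "A \<in> SU2" for A i j
    proof -
      have "(conj_transpose A ** A) $ j $ j = 1" using A by (simp add: mat_def)
      then have "(\<Sum>k\<in>UNIV. cnj (A $ k $ j) * A $ k $ j) = 1"
        by (simp add: matrix_matrix_mult_def conj_transpose_def)
      then have "(\<Sum>k\<in>UNIV. complex_of_real ((cmod (A $ k $ j))\<^sup>2)) = 1"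
        by (simp only: complex_norm_square mult.commute)
      then have "complex_of_real (\<Sum>k\<in>UNIV. (cmod (A $ k $ j))\<^sup>2) = of_real 1"
        by (simp only: of_real_sum of_real_1)
      then have s: "(\<Sum>k\<in>UNIV. (cmod (A $ k $ j))\<^sup>2) = 1"
        by (simp only: of_real_eq_iff)
      have "(cmod (A $ i $ j))\<^sup>2 \<le> (\<Sum>k\<in>UNIV. (cmod (A $ k $ j))\<^sup>2)"
        by (rule member_le_sum) auto
      then show ?thesis using s by (simp add: power_le_one_iff abs_square_le_1)
    qed
    have n: "norm A \<le> (\<Sum>i\<in>UNIV. \<Sum>j\<in>UNIV. cmod (A $ i $ j))" for A :: cmat2
    proof -
      have "norm A \<le> (\<Sum>i\<in>UNIV. norm (A $ i))"
        unfolding norm_vec_def by (rule L2_set_le_sum) simp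
      also have "\<dots> \<le> (\<Sum>i\<in>UNIV. \<Sum>j\<in>UNIV. cmod (A $ i $ j))"
        by (intro sum_mono) (simp add: norm_vec_def L2_set_le_sum)
      finally show ?thesis .
    qed
    have "norm A \<le> 4" if "A \<in> SU2" for A
      using n[of A] *[OF that, of 1 1] *[OF that, of 1 2] *[OF that, of 2 1] *[OF that, of 2 2]
      unfolding sum_2 by linarith
    then show ?thesis by (auto simp: bounded_iff)
  qed
  ultimately show ?thesis by (simp add: compact_eq_bounded_closed)
qed

section \<open>One-parameter subgroups\<close>

definition eX :: cmat2 where "eX = vector [vector [0, 1], vector [-1, 0]]"
definition eY :: cmat2 where "eY = vector [vector [0, \<i>], vector [\<i>, 0]]"

text \<open>The value of the exponential series at \<open>s E\<close> when \<open>E\<^sup>2 = -1\<close>, which holds for both generators.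
  All derivatives along the fields are computed from this closed form.\<close>

definition rot :: "cmat2 \<Rightarrow> real \<Rightarrow> cmat2" where
  "rot E s = cos s *\<^sub>R mat 1 + sin s *\<^sub>R E"

lemma eX_square: "eX ** eX = - mat 1"
  by (simp add: eX_def matrix_matrix_mult_def vec_eq_iff mat_def forall_2 sum_2)

lemma eY_square: "eY ** eY = - mat 1"
  by (simp add: eY_def matrix_matrix_mult_def vec_eq_iff mat_def forall_2 sum_2)

lemma rot_in_SU2:
  assumes "E \<in> {eX, eY}" shows "rot E s \<in> SU2"
proof -
  have *: "complex_of_real (cos s) * complex_of_real (cos s) + complex_of_real (sin s) * complex_of_real (sin s) = 1"
    by (metis of_real_1 of_real_add of_real_mult sin_cos_squared_add3)
  have X: "rot eX s = vector [vector [of_real (cos s), of_real (sin s)], vector [- of_real (sin s), of_real (cos s)]]"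
    by (simp add: rot_def eX_def vec_eq_iff mat_def forall_2 scaleR_conv_of_real[where 'a=complex])
  have Y: "rot eY s = vector [vector [of_real (cos s), \<i> * of_real (sin s)], vector [\<i> * of_real (sin s), of_real (cos s)]]"
    by (simp add: rot_def eY_def vec_eq_iff mat_def forall_2 scaleR_conv_of_real[where 'a=complex])
  have **: "\<i> * complex_of_real (sin s) * (\<i> * complex_of_real (sin s)) =
      - (complex_of_real (sin s) * complex_of_real (sin s))"
    by (simp add: algebra_simps)
  have "rot eX s \<in> SU2" "rot eY s \<in> SU2"
    using * unfolding X Y SU2_def
    by (simp_all add: conj_transpose_def matrix_matrix_mult_def vec_eq_iff mat_def forall_2 sum_2 det_2
        ** add.commute)
  then show ?thesis using assms by blast
qed

lemma rot_0 [simp]: "rot E 0 = mat 1"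
  by (simp add: rot_def)

lemma rot_add:
  assumes "E ** E = - mat 1"
  shows "rot E (s + r) = rot E s ** rot E r"
  using assms
  by (simp add: rot_def matrix_add_ldistrib matrix_mult_add_left matrix_mult_scaleR_left
      matrix_mult_scaleR_right cos_add sin_add scaleR_add_left scaleR_add_right scaleR_diff_left scaleR_diff_right mult.commute)

text \<open>The even terms of the exponential series are multiples of the identity and add up to the
  cosine; the odd ones are multiples of \<open>E\<close> and add up to the sine.\<close>

lemma matrix_exp_eq_rot:
  assumes E: "E ** E = - mat 1"
  shows "matrix_exp (s *\<^sub>R E) = rot E s"
proof -
  let ?it = "\<lambda>n. ((\<lambda>B. (s *\<^sub>R E) ** B) ^^ n) (mat 1 :: cmat2)"
  have step: "(s *\<^sub>R E) ** ((s *\<^sub>R E) ** B) = - (s\<^sup>2 *\<^sub>R B)" for B :: cmat2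
  proof -
    have "(s *\<^sub>R E) ** ((s *\<^sub>R E) ** B) = s\<^sup>2 *\<^sub>R ((E ** E) ** B)"
      by (simp add: matrix_mult_scaleR_left matrix_mult_scaleR_right matrix_mul_assoc power2_eq_square)
    also have "(E ** E) ** B = (-1) *\<^sub>R B"
      unfolding E by (metis matrix_mul_lid matrix_mult_scaleR_left scaleR_minus1_left)
    finally show ?thesis by simp
  qed
  have it: "?it (2 * n) = ((-1) ^ n * s ^ (2 * n)) *\<^sub>R mat 1 \<and>
            ?it (Suc (2 * n)) = ((-1) ^ n * s ^ (Suc (2 * n))) *\<^sub>R E" for n
  proof (induction n)
    case 0
    then show ?case by simp
  next
    case (Suc n)
    have "?it (2 * Suc n) = - (s\<^sup>2 *\<^sub>R ?it (2 * n))"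
      "?it (Suc (2 * Suc n)) = - (s\<^sup>2 *\<^sub>R ?it (Suc (2 * n)))"
      using step[of "?it (2 * n)"] step[of "?it (Suc (2 * n))"]
      by (simp_all only: mult_Suc_right add_2_eq_Suc funpow.simps o_apply)
    then show ?case
      unfolding Suc.IH[THEN conjunct1] Suc.IH[THEN conjunct2]
      by (simp add: power2_eq_square mult.assoc mult.left_commute)
  qed
  have coeff: "(1 / fact n) *\<^sub>R ?it n = (cos_coeff n *\<^sub>R s ^ n) *\<^sub>R mat 1 + (sin_coeff n *\<^sub>R s ^ n) *\<^sub>R E" for n
  proof (cases "even n")
    case True
    then obtain m where n: "n = 2 * m" by auto
    show ?thesis
      unfolding n it[THEN conjunct1] by (simp add: cos_coeff_def sin_coeff_def)
  next
    case False
    then obtain m where n: "n = Suc (2 * m)" by (auto elim: oddE)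
    show ?thesis
      unfolding n it[THEN conjunct2]
      by (simp add: cos_coeff_def sin_coeff_def del: power_Suc fact_Suc)
  qed
  have "(\<lambda>n. (cos_coeff n *\<^sub>R s ^ n) *\<^sub>R mat 1 + (sin_coeff n *\<^sub>R s ^ n) *\<^sub>R E) sums rot E s"
    unfolding rot_def
    by (intro sums_add bounded_linear.sums[OF bounded_linear_scaleR_left] cos_converges sin_converges)
  then show ?thesis unfolding matrix_exp_def coeff by (simp add: sums_iff)
qed

section \<open>Smooth functions\<close>

lemma frechet_derivative_cong_open:
  assumes "open U" "x \<in> U" "\<And>y. y \<in> U \<Longrightarrow> F y = G y"
  shows "frechet_derivative F (at x) = frechet_derivative G (at x)"
proof -
  have "(F has_derivative D) (at x) \<longleftrightarrow> (G has_derivative D) (at x)" for D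
    using assms has_derivative_transform_within_open[of F D x UNIV U G]
      has_derivative_transform_within_open[of G D x UNIV U F] by auto
  then show ?thesis by (simp add: frechet_derivative_def)
qed

lemma Ck_on_cong:
  assumes "open U" "\<And>y. y \<in> U \<Longrightarrow> F y = G y"
  shows "Ck_on k F U \<longleftrightarrow> Ck_on k G U"
  using assms
proof (induction k arbitrary: F G)
  case 0
  then show ?case using continuous_on_cong by force
next
  case (Suc k)
  have "F differentiable (at x) \<longleftrightarrow> G differentiable (at x)" if "x \<in> U" for x
    using Suc.prems that has_derivative_transform_within_open[of F _ x UNIV U G]
      has_derivative_transform_within_open[of G _ x UNIV U F]
    unfolding differentiable_def by auto
  moreover have "Ck_on k (\<lambda>x. frechet_derivative F (at x) v) U \<longleftrightarrow>
      Ck_on k (\<lambda>x. frechet_derivative G (at x) v) U" for v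
    by (rule Suc.IH[OF Suc.prems(1)]) (simp add: frechet_derivative_cong_open[OF Suc.prems(1) _ Suc.prems(2)])
  ultimately show ?case by simp
qed

lemma Ck_on_SucD: "Ck_on (Suc k) F U \<Longrightarrow> Ck_on k F U"
proof (induction k arbitrary: F)
  case 0
  then show ?case
    by (auto intro!: continuous_at_imp_continuous_on differentiable_imp_continuous_within)
next
  case (Suc k)
  then show ?case by (metis Ck_on.simps(2))
qed

lemma Ck_on_subset: "Ck_on k F U \<Longrightarrow> V \<subseteq> U \<Longrightarrow> Ck_on k F V"
  by (induction k arbitrary: F) (auto intro: continuous_on_subset)

lemma Ck_on_const: "Ck_on k (\<lambda>x. c) U"
  by (induction k arbitrary: c) simp_all

lemma Ck_on_linear:
  assumes "linear l" shows "Ck_on k l U"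
proof -
  have l: "bounded_linear l" using assms by (simp add: linear_conv_bounded_linear)
  have "frechet_derivative l (at x) = l" for x
    using bounded_linear_imp_has_derivative[OF l] frechet_derivative_at by metis
  then show ?thesis
    by (cases k) (simp_all add: Ck_on_const bounded_linear_imp_differentiable[OF l]
        linear_continuous_on[OF l])
qed

lemma Ck_on_has_derivative:
  "Ck_on (Suc k) F U \<Longrightarrow> x \<in> U \<Longrightarrow> (F has_derivative frechet_derivative F (at x)) (at x)"
  by (simp add: frechet_derivative_works)

lemma Ck_on_add:
  assumes "open U" "Ck_on k F U" "Ck_on k G U"
  shows "Ck_on k (\<lambda>x. F x + G x) U"
  using assms
proof (induction k arbitrary: F G)
  case 0
  then show ?case by (simp add: continuous_on_add)
next
  case (Suc k)
  have d: "frechet_derivative (\<lambda>x. F x + G x) (at x) v =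
      frechet_derivative F (at x) v + frechet_derivative G (at x) v" if "x \<in> U" for x v
    using frechet_derivative_at[OF has_derivative_add[OF Ck_on_has_derivative[OF Suc.prems(2) that]
          Ck_on_has_derivative[OF Suc.prems(3) that]], symmetric] by simp
  have "Ck_on k (\<lambda>x. frechet_derivative (\<lambda>x. F x + G x) (at x) v) U" for v
    using Suc by (subst Ck_on_cong[OF Suc.prems(1) d]) auto
  then show ?case using Suc.prems by simp
qed

lemma Ck_on_sum:
  assumes "open U" "\<And>i. i \<in> I \<Longrightarrow> Ck_on k (F i) U"
  shows "Ck_on k (\<lambda>x. \<Sum>i\<in>I. F i x) U"
  using assms(2)
  by (induction I rule: infinite_finite_induct) (auto intro: Ck_on_const Ck_on_add[OF assms(1)])

lemma Ck_on_mult: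
  assumes "open U" "Ck_on k F U" "Ck_on k G U"
  shows "Ck_on k (\<lambda>x. F x * G x) U"
  using assms
proof (induction k arbitrary: F G)
  case 0
  then show ?case by (simp add: continuous_on_mult)
next
  case (Suc k)
  have d: "frechet_derivative (\<lambda>x. F x * G x) (at x) v =
      F x * frechet_derivative G (at x) v + frechet_derivative F (at x) v * G x" if "x \<in> U" for x v
    using frechet_derivative_at[OF has_derivative_mult[OF Ck_on_has_derivative[OF Suc.prems(2) that]
          Ck_on_has_derivative[OF Suc.prems(3) that]], symmetric] by simp
  have "Ck_on k F U" "Ck_on k G U" using Suc.prems Ck_on_SucD by blast+
  then have "Ck_on k (\<lambda>x. frechet_derivative (\<lambda>x. F x * G x) (at x) v) U" for v
    using Suc.prems
    by (subst Ck_on_cong[OF Suc.prems(1) d]) (auto intro!: Ck_on_add Suc.IH)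
  then show ?case using Suc.prems by simp
qed

lemma Ck_on_compose_linear:
  fixes T :: "'a::euclidean_space \<Rightarrow> 'b::euclidean_space"
  assumes "linear T" "open U" "Ck_on k F U"
  shows "Ck_on k (\<lambda>x. F (T x)) (T -` U)"
  using assms(3)
proof (induction k arbitrary: F)
  case 0
  then show ?case
    using continuous_on_compose2[OF _ continuous_on_linear[OF assms(1)], of U F "T -` U"] by auto
next
  case (Suc k)
  have T: "(T has_derivative T) (at x)" for x
    using assms(1) by (simp add: linear_conv_bounded_linear bounded_linear_imp_has_derivative)
  have D: "((\<lambda>x. F (T x)) has_derivative (\<lambda>v. frechet_derivative F (at (T x)) (T v))) (at x)"
    if "x \<in> T -` U" for x
    using Suc.prems that has_derivative_compose[OF T, of F _ x] by (auto simp: frechet_derivative_works)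
  have d: "frechet_derivative (\<lambda>x. F (T x)) (at x) = (\<lambda>v. frechet_derivative F (at (T x)) (T v))"
    if "x \<in> T -` U" for x
    using frechet_derivative_at[OF D[OF that]] by simp
  have "Ck_on k (\<lambda>x. frechet_derivative (\<lambda>x. F (T x)) (at x) v) (T -` U)" for v
  proof (subst Ck_on_cong)
    show "open (T -` U)"
      using assms(2) continuous_on_linear[OF assms(1), of UNIV] by (simp add: open_vimage)
    show "frechet_derivative (\<lambda>x. F (T x)) (at x) v = frechet_derivative F (at (T x)) (T v)"
      if "x \<in> T -` U" for x using d[OF that] by simp
    show "Ck_on k (\<lambda>x. frechet_derivative F (at (T x)) (T v)) (T -` U)"
      using Suc.prems by (intro Suc.IH[of "\<lambda>y. frechet_derivative F (at y) (T v)"]) simp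
  qed
  then show ?case using D unfolding Ck_on.simps differentiable_def by blast
qed

text \<open>Here the direction of differentiation varies with the point.  Expanding it in a basis reduces
  the claim to products of linear functions with derivatives in fixed directions.\<close>

lemma Ck_on_derivative_along_linear:
  fixes F :: "'a::euclidean_space \<Rightarrow> real"
  assumes "open U" "linear l" "\<And>k. Ck_on k F U"
  shows "Ck_on k (\<lambda>x. frechet_derivative F (at x) (l x)) U"
proof -
  have d: "frechet_derivative F (at x) (l x) =
      (\<Sum>b\<in>Basis. (l x \<bullet> b) * frechet_derivative F (at x) b)" if "x \<in> U" for x
  proof -
    have "linear (frechet_derivative F (at x))"
      using assms(3)[of 1] that by (auto intro: linear_frechet_derivative)
    then have "frechet_derivative F (at x) (\<Sum>b\<in>Basis. (l x \<bullet> b) *\<^sub>R b) =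
      (\<Sum>b\<in>Basis. (l x \<bullet> b) * frechet_derivative F (at x) b)"
      by (simp add: linear_sum linear_cmul)
    then show ?thesis by (simp add: euclidean_representation)
  qed
  have "Ck_on k (\<lambda>x. l x \<bullet> b) U" for b
    using assms(2) by (intro Ck_on_linear linearI) (simp_all add: linear_add linear_cmul inner_add_left)
  moreover have "Ck_on k (\<lambda>x. frechet_derivative F (at x) b) U" for b
    using assms(3)[of "Suc k"] by simp
  ultimately have "Ck_on k (\<lambda>x. \<Sum>b\<in>Basis. (l x \<bullet> b) * frechet_derivative F (at x) b) U"
    by (intro Ck_on_sum Ck_on_mult assms(1)) auto
  also have "?this \<longleftrightarrow> ?thesis"
    by (rule Ck_on_cong[OF assms(1)]) (simp add: d)
  finally show ?thesis .
qed

section \<open>Smooth functions on the group\<close>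

lemma smooth_on_SU2E:
  assumes "smooth_on_SU2 f" "g \<in> SU2"
  obtains U F where "open U" "g \<in> U" "\<And>k. Ck_on k F U" "\<And>h. h \<in> U \<Longrightarrow> h \<in> SU2 \<Longrightarrow> F h = f h"
  using assms unfolding smooth_on_SU2_def by (metis IntI)

lemma smooth_on_SU2_const: "smooth_on_SU2 (\<lambda>x. c)"
  unfolding smooth_on_SU2_def using open_UNIV Ck_on_const by blast

lemma smooth_on_SU2_binop:
  assumes op: "\<And>k U F G. open U \<Longrightarrow> Ck_on k F U \<Longrightarrow> Ck_on k G U \<Longrightarrow> Ck_on k (\<lambda>x :: cmat2. op (F x) (G x)) U"
    and "smooth_on_SU2 f" "smooth_on_SU2 h"
  shows "smooth_on_SU2 (\<lambda>x. op (f x) (h x))"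
  unfolding smooth_on_SU2_def
proof
  fix g assume "g \<in> SU2"
  obtain U F where 1: "open U" "g \<in> U" "\<And>k. Ck_on k F U" "\<And>h. h \<in> U \<Longrightarrow> h \<in> SU2 \<Longrightarrow> F h = f h"
    using smooth_on_SU2E[OF assms(2) \<open>g \<in> SU2\<close>] by blast
  obtain V G where 2: "open V" "g \<in> V" "\<And>k. Ck_on k G V" "\<And>a. a \<in> V \<Longrightarrow> a \<in> SU2 \<Longrightarrow> G a = h a"
    using smooth_on_SU2E[OF assms(3) \<open>g \<in> SU2\<close>] by blast
  have "Ck_on k (\<lambda>x. op (F x) (G x)) (U \<inter> V)" for k
    using 1 2 by (intro op) (auto intro: Ck_on_subset)
  then show "\<exists>U Fa. open U \<and> g \<in> U \<and> (\<forall>k. Ck_on k Fa U) \<and> (\<forall>x\<in>U \<inter> SU2. Fa x = op (f x) (h x))"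
    using 1 2 by (intro exI[of _ "U \<inter> V"] exI[of _ "\<lambda>x. op (F x) (G x)"]) auto
qed

lemma smooth_on_SU2_add:
  "smooth_on_SU2 f \<Longrightarrow> smooth_on_SU2 h \<Longrightarrow> smooth_on_SU2 (\<lambda>x. f x + h x)"
  by (rule smooth_on_SU2_binop[of "(+)"]) (rule Ck_on_add)

lemma smooth_on_SU2_mult:
  "smooth_on_SU2 f \<Longrightarrow> smooth_on_SU2 h \<Longrightarrow> smooth_on_SU2 (\<lambda>x. f x * h x)"
  by (rule smooth_on_SU2_binop[of "(*)"]) (rule Ck_on_mult)

lemma smooth_on_SU2_diff:
  "smooth_on_SU2 f \<Longrightarrow> smooth_on_SU2 h \<Longrightarrow> smooth_on_SU2 (\<lambda>x. f x - h x)"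
  using smooth_on_SU2_add[OF _ smooth_on_SU2_mult[OF smooth_on_SU2_const[of "-1"]]] by fastforce

lemma smooth_on_SU2_compose_linear:
  assumes "linear T" "\<And>x. x \<in> SU2 \<Longrightarrow> T x \<in> SU2" "smooth_on_SU2 f"
  shows "smooth_on_SU2 (\<lambda>x. f (T x))"
  unfolding smooth_on_SU2_def
proof
  fix g assume g: "g \<in> SU2"
  obtain U F where 1: "open U" "T g \<in> U" "\<And>k. Ck_on k F U" "\<And>h. h \<in> U \<Longrightarrow> h \<in> SU2 \<Longrightarrow> F h = f h"
    using smooth_on_SU2E[OF assms(3) assms(2)[OF g]] by blast
  have "open (T -` U)"
    using 1 continuous_on_linear[OF assms(1), of UNIV] by (simp add: open_vimage)
  then show "\<exists>U Fa. open U \<and> g \<in> U \<and> (\<forall>k. Ck_on k Fa U) \<and> (\<forall>x\<in>U \<inter> SU2. Fa x = f (T x))"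
    using 1 assms(2) by (intro exI[of _ "T -` U"] exI[of _ "\<lambda>x. F (T x)"])
      (auto intro: Ck_on_compose_linear[OF assms(1)])
qed

lemma smooth_on_SU2_imp_continuous_on:
  assumes "smooth_on_SU2 f" shows "continuous_on SU2 f"
  unfolding continuous_on_eq_continuous_within
proof
  fix g assume g: "g \<in> SU2"
  obtain U F where 1: "open U" "g \<in> U" "\<And>k. Ck_on k F U" "\<And>h. h \<in> U \<Longrightarrow> h \<in> SU2 \<Longrightarrow> F h = f h"
    using smooth_on_SU2E[OF assms(1) g] by blast
  have "continuous (at g within SU2) F"
    using 1(1,2) 1(3)[of 0] by (auto simp: continuous_on_eq_continuous_at intro: continuous_at_imp_continuous_at_within)
  moreover have "\<forall>\<^sub>F x in at g within SU2. F x = f x"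
    using 1 by (auto simp: eventually_at_topological)
  ultimately show "continuous (at g within SU2) f"
    using 1(2,4) g by (simp add: continuous_within Lim_transform_eventually)
qed

section \<open>Derivatives along one-parameter subgroups\<close>

lemma units_square: "E \<in> {eX, eY} \<Longrightarrow> E ** E = - mat 1"
  using eX_square eY_square by blast

lemma field_eq_rot:
  assumes "E \<in> {eX, eY}"
  shows "left_inv_field E f g = deriv (\<lambda>s. f (g ** rot E s)) 0"
  unfolding left_inv_field_def using matrix_exp_eq_rot[OF units_square[OF assms]] by simp

lemma field_X_eq: "field_X = left_inv_field eX" 
  by (simp add: field_X_def eX_def)

lemma field_Y_eq: "field_Y = left_inv_field eY" 
  by (simp add: field_Y_def eY_def)

text \<open>The curve \<open>s \<mapsto> g exp (s E)\<close> stays in the group and has velocity \<open>g E\<close> at \<open>0\<close>, so the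
  derivative of \<open>f\<close> along it can be read off from any smooth local extension \<open>F\<close>.\<close>

lemma has_derivative_extension_along_rot:
  assumes "E \<in> {eX, eY}" "open U" "g \<in> U" "g \<in> SU2" "F differentiable (at g)"
    "\<And>h. h \<in> U \<Longrightarrow> h \<in> SU2 \<Longrightarrow> F h = f h"
  shows "((\<lambda>s. f (g ** rot E s)) has_real_derivative frechet_derivative F (at g) (g ** E)) (at 0)"
proof -
  have rot: "g ** rot E s = cos s *\<^sub>R g + sin s *\<^sub>R (g ** E)" for s
    by (simp add: rot_def matrix_add_ldistrib matrix_mult_scaleR_right)
  have r: "((\<lambda>s. g ** rot E s) has_derivative (\<lambda>s. s *\<^sub>R (g ** E))) (at 0)"
    unfolding rot by (auto intro!: derivative_eq_intros)
  have "(F has_derivative frechet_derivative F (at g)) (at (g ** rot E 0))"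
    using assms(5) by (simp add: frechet_derivative_works)
  from has_derivative_compose[OF r this]
  have d: "((\<lambda>s. F (g ** rot E s)) has_derivative (\<lambda>s. frechet_derivative F (at g) (s *\<^sub>R (g ** E)))) (at 0)" .
  have "frechet_derivative F (at g) (s *\<^sub>R (g ** E)) = frechet_derivative F (at g) (g ** E) * s" for s
    using linear_frechet_derivative[OF assms(5)] by (simp add: linear_cmul mult.commute)
  with d have d: "((\<lambda>s. F (g ** rot E s)) has_real_derivative frechet_derivative F (at g) (g ** E)) (at 0)"
    by (simp add: has_field_derivative_def)
  have o: "open ((\<lambda>s. g ** rot E s) -` U)"
    unfolding rot using assms(2) by (intro open_vimage continuous_intros)
  show ?thesis
    by (rule has_field_derivative_transform_within_open[OF d o])
      (use assms in \<open>auto simp: rot_in_SU2\<close>)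
qed

lemma smooth_on_SU2_field:
  assumes E: "E \<in> {eX, eY}" and f: "smooth_on_SU2 f"
  shows "smooth_on_SU2 (left_inv_field E f)"
  unfolding smooth_on_SU2_def
proof
  fix g assume g: "g \<in> SU2"
  obtain U F where 1: "open U" "g \<in> U" "\<And>k. Ck_on k F U" "\<And>h. h \<in> U \<Longrightarrow> h \<in> SU2 \<Longrightarrow> F h = f h"
    using smooth_on_SU2E[OF f g] by blast
  have "left_inv_field E f h = frechet_derivative F (at h) (h ** E)" if "h \<in> U" "h \<in> SU2" for h
  proof -
    have "F differentiable (at h)" using that 1(3)[of 1] by simp
    from has_derivative_extension_along_rot[OF E 1(1) that this 1(4)]
    show ?thesis unfolding field_eq_rot[OF E] by (rule DERIV_imp_deriv)
  qed
  then show "\<exists>U Fa. open U \<and> g \<in> U \<and> (\<forall>k. Ck_on k Fa U) \<and> (\<forall>x\<in>U \<inter> SU2. Fa x = left_inv_field E f x)"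
    using 1 by (intro exI[of _ U] exI[of _ "\<lambda>x. frechet_derivative F (at x) (x ** E)"])
      (auto intro: Ck_on_derivative_along_linear linear_matrix_mult_right)
qed

lemma has_derivative_along_rot:
  assumes E: "E \<in> {eX, eY}" and f: "smooth_on_SU2 f" and g: "g \<in> SU2"
  shows "((\<lambda>s. f (g ** rot E s)) has_real_derivative left_inv_field E f (g ** rot E s)) (at s)"
proof -
  have *: "((\<lambda>s. f (h ** rot E s)) has_real_derivative left_inv_field E f h) (at 0)" if h: "h \<in> SU2" for h
  proof -
    obtain U F where 1: "open U" "h \<in> U" "\<And>k. Ck_on k F U" "\<And>h. h \<in> U \<Longrightarrow> h \<in> SU2 \<Longrightarrow> F h = f h"
      using smooth_on_SU2E[OF f h] by blast
    have "F differentiable (at h)" using 1(2) 1(3)[of 1] by simp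
    from has_derivative_extension_along_rot[OF E 1(1,2) h this 1(4)]
    show ?thesis unfolding field_eq_rot[OF E] using DERIV_imp_deriv by metis
  qed
  have "g ** rot E s \<in> SU2" using g E by (simp add: rot_in_SU2)
  from *[OF this] have "((\<lambda>r. f (g ** rot E (s + r))) has_real_derivative left_inv_field E f (g ** rot E s)) (at 0)"
    by (simp add: rot_add[OF units_square[OF E]] matrix_mul_assoc)
  then show ?thesis
    using DERIV_shift[of "\<lambda>s. f (g ** rot E s)" _ 0 s] by (simp add: add.commute)
qed

section \<open>Haar integration\<close>

lemma continuous_on_SU2_bounded:
  fixes u :: "cmat2 \<Rightarrow> real"
  assumes "continuous_on SU2 u"
  obtains B where "B \<ge> 0" "\<And>x. x \<in> SU2 \<Longrightarrow> \<bar>u x\<bar> \<le> B"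
proof -
  have "bounded (u ` SU2)"
    using compact_continuous_image[OF assms compact_SU2] by (rule compact_imp_bounded)
  then obtain B where B: "\<And>x. x \<in> SU2 \<Longrightarrow> \<bar>u x\<bar> \<le> B" by (auto simp: bounded_iff)
  show thesis
  proof (rule that)
    show "B \<ge> 0" using B[OF SU2_one] by linarith
  qed (rule B)
qed

lemma continuous_on_SU2_compose:
  "continuous_on SU2 u \<Longrightarrow> continuous_on SU2 T \<Longrightarrow> (\<And>x. x \<in> SU2 \<Longrightarrow> T x \<in> SU2) \<Longrightarrow>
    continuous_on SU2 (\<lambda>x. u (T x))"
  by (rule continuous_on_compose2[of SU2 u]) auto

locale haar =
  fixes \<mu> :: "cmat2 measure"
  assumes haar: "haar_probability \<mu>"
begin

sublocale prob_space \<mu>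
  using haar by (simp add: haar_probability_def)

lemma sets_haar [measurable_cong]: "sets \<mu> = sets (restrict_space borel SU2)"
  using haar by (simp add: haar_probability_def)

lemma space_haar: "space \<mu> = SU2"
  using sets_eq_imp_space_eq[OF sets_haar] by (simp add: space_restrict_space)

lemma continuous_measurable:
  fixes u :: "cmat2 \<Rightarrow> 'b::topological_space"
  assumes "continuous_on SU2 u" shows "u \<in> borel_measurable \<mu>"
  using borel_measurable_continuous_on_restrict[OF assms] measurable_cong_sets[OF sets_haar] by blast

lemma continuous_integrable:
  fixes u :: "cmat2 \<Rightarrow> real"
  assumes "continuous_on SU2 u" shows "integrable \<mu> u"
proof -
  obtain B where "\<And>x. x \<in> SU2 \<Longrightarrow> \<bar>u x\<bar> \<le> B" using continuous_on_SU2_bounded[OF assms] by blast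
  then show ?thesis
    by (intro integrable_const_bound[of _ B] continuous_measurable assms) (auto simp: space_haar)
qed

lemma integral_cong_SU2:
  "(\<And>x. x \<in> SU2 \<Longrightarrow> u x = v x) \<Longrightarrow> integral\<^sup>L \<mu> u = integral\<^sup>L \<mu> v"
  by (rule Bochner_Integration.integral_cong) (auto simp: space_haar)

declare prob_space [simp]

lemma abs_integral_le:
  fixes u :: "cmat2 \<Rightarrow> real"
  assumes "\<And>x. x \<in> SU2 \<Longrightarrow> \<bar>u x\<bar> \<le> B" "B \<ge> 0"
  shows "\<bar>integral\<^sup>L \<mu> u\<bar> \<le> B"
proof (cases "integrable \<mu> u")
  case True
  have "\<bar>integral\<^sup>L \<mu> u\<bar> \<le> (\<integral>x. \<bar>u x\<bar> \<partial>\<mu>)" by (rule integral_abs_bound)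
  also have "\<dots> \<le> (\<integral>x. B \<partial>\<mu>)"
    using True assms by (intro integral_mono) (auto simp: space_haar)
  finally show ?thesis by simp
next
  case False
  then show ?thesis using assms by (simp add: not_integrable_integral_eq)
qed

lemma measurable_SU2_map:
  assumes "continuous_on SU2 T" "\<And>x. x \<in> SU2 \<Longrightarrow> T x \<in> SU2"
  shows "T \<in> measurable \<mu> \<mu>"
proof -
  have "T \<in> measurable \<mu> (restrict_space borel SU2)"
    using assms by (intro measurable_restrict_space2 continuous_measurable) (auto simp: space_haar)
  then show ?thesis using measurable_cong_sets[OF refl sets_haar] by blast
qed

lemma integral_left_translate:
  fixes u :: "cmat2 \<Rightarrow> real"
  assumes "a \<in> SU2" "continuous_on SU2 u"
  shows "(\<integral>x. u (a ** x) \<partial>\<mu>) = integral\<^sup>L \<mu> u"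
proof -
  have "integral\<^sup>L \<mu> u = integral\<^sup>L (distr \<mu> \<mu> (\<lambda>h. a ** h)) u"
    using haar assms(1) by (simp add: haar_probability_def)
  also have "\<dots> = (\<integral>x. u (a ** x) \<partial>\<mu>)"
  proof (rule integral_distr)
    show "(\<lambda>h. a ** h) \<in> measurable \<mu> \<mu>"
      using assms(1)
      by (intro measurable_SU2_map continuous_on_matrix_mult continuous_on_const continuous_on_id) simp
  qed (rule continuous_measurable[OF assms(2)])
  finally show ?thesis by simp
qed

lemma integral_right_translate:
  fixes u :: "cmat2 \<Rightarrow> real"
  assumes "a \<in> SU2" "continuous_on SU2 u"
  shows "(\<integral>x. u (x ** a) \<partial>\<mu>) = integral\<^sup>L \<mu> u"
proof -
  have "integral\<^sup>L \<mu> u = integral\<^sup>L (distr \<mu> \<mu> (\<lambda>h. h ** a)) u"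
    using haar assms(1) by (simp add: haar_probability_def)
  also have "\<dots> = (\<integral>x. u (x ** a) \<partial>\<mu>)"
  proof (rule integral_distr)
    show "(\<lambda>h. h ** a) \<in> measurable \<mu> \<mu>"
      using assms(1)
      by (intro measurable_SU2_map continuous_on_matrix_mult continuous_on_const continuous_on_id) simp
  qed (rule continuous_measurable[OF assms(2)])
  finally show ?thesis by simp
qed

lemma integral_swap:
  fixes H :: "cmat2 \<Rightarrow> cmat2 \<Rightarrow> real"
  assumes "continuous_on (SU2 \<times> SU2) (\<lambda>z. H (fst z) (snd z))"
  shows "(\<integral>x. (\<integral>y. H x y \<partial>\<mu>) \<partial>\<mu>) = (\<integral>y. (\<integral>x. H x y \<partial>\<mu>) \<partial>\<mu>)"
proof -
  interpret P: pair_prob_space \<mu> \<mu> ..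
  have i: "(\<lambda>x. x) \<in> borel_measurable \<mu>"
    by (intro continuous_measurable continuous_on_id)
  have "(\<lambda>z. (fst z, snd z)) \<in> borel_measurable (\<mu> \<Otimes>\<^sub>M \<mu>)"
    by (intro borel_measurable_Pair measurable_compose[OF measurable_fst i]
        measurable_compose[OF measurable_snd i])
  then have "(\<lambda>z. z) \<in> measurable (\<mu> \<Otimes>\<^sub>M \<mu>) (restrict_space borel (SU2 \<times> SU2))"
    by (intro measurable_restrict_space2) (auto simp: space_pair_measure space_haar)
  from measurable_compose[OF this borel_measurable_continuous_on_restrict[OF assms]]
  have m: "(\<lambda>z. H (fst z) (snd z)) \<in> borel_measurable (\<mu> \<Otimes>\<^sub>M \<mu>)" .
  have "bounded ((\<lambda>z. H (fst z) (snd z)) ` (SU2 \<times> SU2))"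
    using compact_continuous_image[OF assms compact_Times[OF compact_SU2 compact_SU2]]
    by (rule compact_imp_bounded)
  then obtain B where "\<forall>r \<in> (\<lambda>z. H (fst z) (snd z)) ` (SU2 \<times> SU2). norm r \<le> B"
    unfolding bounded_iff by blast
  then have "AE z in \<mu> \<Otimes>\<^sub>M \<mu>. norm (H (fst z) (snd z)) \<le> B"
    by (intro AE_I2) (simp add: space_pair_measure space_haar mem_Times_iff)
  then have "integrable (\<mu> \<Otimes>\<^sub>M \<mu>) (\<lambda>z. H (fst z) (snd z))"
    using m by (rule P.integrable_const_bound)
  then have "integrable (\<mu> \<Otimes>\<^sub>M \<mu>) (case_prod H)" by (simp only: case_prod_beta')
  from P.Fubini_integral[OF this] show ?thesis by (rule sym)
qed

text \<open>Averaging \<open>u(x\<^sup>-\<^sup>1 y)\<close> over both variables gives the integral of \<open>u\<close> when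
  integrated over \<open>y\<close> first, and the integral of its reflection when integrated over \<open>x\<close> first.\<close>

lemma integral_inverse:
  fixes u :: "cmat2 \<Rightarrow> real"
  assumes "continuous_on SU2 u"
  shows "(\<integral>x. u (conj_transpose x) \<partial>\<mu>) = integral\<^sup>L \<mu> u"
proof -
  have "integral\<^sup>L \<mu> u = (\<integral>x. (\<integral>y. u (conj_transpose x ** y) \<partial>\<mu>) \<partial>\<mu>)"
  proof -
    have "(\<integral>x. (\<integral>y. u (conj_transpose x ** y) \<partial>\<mu>) \<partial>\<mu>) = (\<integral>x. integral\<^sup>L \<mu> u \<partial>\<mu>)"
      by (intro integral_cong_SU2 integral_left_translate assms) simp
    then show ?thesis by simp
  qed
  also have "\<dots> = (\<integral>y. (\<integral>x. u (conj_transpose x ** y) \<partial>\<mu>) \<partial>\<mu>)"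
  proof (rule integral_swap, rule continuous_on_compose2[OF assms])
    show "continuous_on (SU2 \<times> SU2) (\<lambda>z. conj_transpose (fst z) ** snd z)"
      by (intro continuous_on_matrix_mult continuous_on_conj_transpose continuous_on_fst
          continuous_on_snd continuous_on_id)
  qed auto
  also have "\<dots> = (\<integral>y. (\<integral>x. u (conj_transpose x) \<partial>\<mu>) \<partial>\<mu>)"
  proof (rule integral_cong_SU2)
    fix y assume y: "y \<in> SU2"
    have "continuous_on SU2 (\<lambda>x. u (conj_transpose x ** y))"
      using y by (intro continuous_on_SU2_compose[OF assms] continuous_intros continuous_on_id) auto
    from integral_left_translate[OF y this, symmetric]
    show "(\<integral>x. u (conj_transpose x ** y) \<partial>\<mu>) = (\<integral>x. u (conj_transpose x) \<partial>\<mu>)"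
      by (simp only: conj_transpose_mult matrix_mul_assoc[symmetric] SU2_inverse_left[OF y] matrix_mul_rid)
  qed
  finally show ?thesis by simp
qed

lemma integral_conjugate:
  fixes u :: "cmat2 \<Rightarrow> real"
  assumes "a \<in> SU2" "continuous_on SU2 u"
  shows "(\<integral>x. u (a ** x ** conj_transpose a) \<partial>\<mu>) = integral\<^sup>L \<mu> u"
proof -
  have "continuous_on SU2 (\<lambda>x. u (x ** conj_transpose a))"
    using assms by (intro continuous_on_SU2_compose[OF assms(2)] continuous_intros continuous_on_id) auto
  from integral_left_translate[OF assms(1) this]
  have "(\<integral>x. u (a ** x ** conj_transpose a) \<partial>\<mu>) = (\<integral>x. u (x ** conj_transpose a) \<partial>\<mu>)" .
  also have "\<dots> = integral\<^sup>L \<mu> u"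
    by (rule integral_right_translate[OF SU2_conj_transpose[OF assms(1)] assms(2)])
  finally show ?thesis .
qed

text \<open>Haar measure has full support: if \<open>u\<^sup>2\<close> vanished almost everywhere but not at \<open>b\<close>, finitely
  many translates of \<open>{u \<noteq> 0}\<close> would cover the compact group by null sets.\<close>

lemma integral_square_eq_0_imp:
  fixes u :: "cmat2 \<Rightarrow> real"
  assumes u: "continuous_on SU2 u" and 0: "(\<integral>x. (u x)\<^sup>2 \<partial>\<mu>) = 0" and b: "b \<in> SU2"
  shows "u b = 0"
proof (rule ccontr)
  assume "u b \<noteq> 0"
  have c: "continuous_on SU2 (\<lambda>x. u (a ** x))" if "a \<in> SU2" for a
    using that by (intro continuous_on_SU2_compose[OF u] continuous_intros continuous_on_id) auto
  have AE: "AE x in \<mu>. u (a ** x) = 0" if a: "a \<in> SU2" for a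
  proof -
    have i: "integrable \<mu> (\<lambda>x. (u (a ** x))\<^sup>2)"
      using c[OF a] by (intro continuous_integrable continuous_intros)
    have "(\<integral>x. (u (a ** x))\<^sup>2 \<partial>\<mu>) = 0"
      using integral_left_translate[OF a, of "\<lambda>x. (u x)\<^sup>2"] u 0 by (simp add: continuous_on_power)
    then show ?thesis using integral_nonneg_eq_0_iff_AE[OF i] by simp
  qed
  define W where "W a = {x \<in> SU2. u (a ** x) \<noteq> 0}" for a
  have o: "openin (top_of_set SU2) (W a)" if "a \<in> SU2" for a
  proof -
    have "W a = SU2 \<inter> (\<lambda>x. u (a ** x)) -` (- {0})" by (auto simp: W_def)
    then show ?thesis using continuous_openin_preimage_gen[OF c[OF that], of "- {0}"] by (simp add: open_Compl)
  qed
  have cover: "SU2 \<subseteq> \<Union> (W ` SU2)"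
  proof
    fix x assume x: "x \<in> SU2"
    have "u ((b ** conj_transpose x) ** x) \<noteq> 0"
      unfolding matrix_mul_assoc[symmetric] SU2_inverse_left[OF x] matrix_mul_rid
      by (rule \<open>u b \<noteq> 0\<close>)
    then have "x \<in> W (b ** conj_transpose x)" using x by (simp add: W_def)
    moreover have "b ** conj_transpose x \<in> SU2"
      using x b by (intro SU2_mult SU2_conj_transpose)
    ultimately show "x \<in> \<Union> (W ` SU2)" by blast
  qed
  obtain D where D: "D \<subseteq> SU2" "finite D" "SU2 \<subseteq> \<Union> (W ` D)"
  proof -
    have "\<forall>c\<in>W ` SU2. openin (top_of_set SU2) c" "SU2 \<subseteq> \<Union> (W ` SU2)"
      using o cover by blast+
    then obtain D' where "D' \<subseteq> W ` SU2" "finite D'" "SU2 \<subseteq> \<Union> D'"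
      using compact_SU2 unfolding compact_eq_openin_cover by meson
    then show thesis using that finite_subset_image[of D' W SU2] by metis
  qed
  have "AE x in \<mu>. \<forall>a\<in>D. u (a ** x) = 0"
    using D AE by (intro AE_finite_allI) auto
  with AE_space have "AE x in \<mu>. False"
  proof eventually_elim
    fix x assume "x \<in> space \<mu>" "\<forall>a\<in>D. u (a ** x) = 0"
    then show False using D(3) unfolding space_haar W_def by blast
  qed
  then show False by simp
qed

end

section \<open>Differentiation in the supremum norm\<close>

text \<open>The derivative at \<open>s\<close>, within \<open>S\<close>, of a curve in the Banach space of continuous functions.
  The \<open>\<epsilon>\<close>-\<open>\<delta>\<close> form avoids difference quotients, so \<open>r = s\<close> needs no special treatment.\<close>

definition has_unif_deriv ::
    "(real \<Rightarrow> cmat2 \<Rightarrow> real) \<Rightarrow> (cmat2 \<Rightarrow> real) \<Rightarrow> real \<Rightarrow> real set \<Rightarrow> bool" where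
  "has_unif_deriv u u' s S \<longleftrightarrow>
     (\<forall>\<epsilon>>0. \<exists>\<delta>>0. \<forall>r\<in>S. \<bar>r - s\<bar> < \<delta> \<longrightarrow>
        (\<forall>x\<in>SU2. \<bar>u r x - u s x - (r - s) * u' x\<bar> \<le> \<epsilon> * \<bar>r - s\<bar>))"

lemma has_unif_derivD:
  assumes "has_unif_deriv u u' s S" "\<epsilon> > 0"
  obtains \<delta> where "\<delta> > 0" "\<And>r x. r \<in> S \<Longrightarrow> \<bar>r - s\<bar> < \<delta> \<Longrightarrow> x \<in> SU2 \<Longrightarrow>
      \<bar>u r x - u s x - (r - s) * u' x\<bar> \<le> \<epsilon> * \<bar>r - s\<bar>"
  using assms unfolding has_unif_deriv_def by meson

lemma has_unif_deriv_subset: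
  "has_unif_deriv u u' s S \<Longrightarrow> S' \<subseteq> S \<Longrightarrow> has_unif_deriv u u' s S'"
  unfolding has_unif_deriv_def by (meson subsetD)

lemma has_unif_deriv_compose:
  assumes "has_unif_deriv u u' s S" "\<And>x. x \<in> SU2 \<Longrightarrow> T x \<in> SU2"
  shows "has_unif_deriv (\<lambda>r x. u r (T x)) (\<lambda>x. u' (T x)) s S"
  using assms unfolding has_unif_deriv_def by meson

lemma has_unif_deriv_const: "has_unif_deriv (\<lambda>r. w) (\<lambda>x. 0) s S"
  unfolding has_unif_deriv_def by (auto intro: exI[of _ 1])

lemma has_unif_deriv_reflect:
  assumes "has_unif_deriv u u' (t - s) S"
  shows "has_unif_deriv (\<lambda>r. u (t - r)) (\<lambda>x. - u' x) s {r. t - r \<in> S}"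
  unfolding has_unif_deriv_def
proof (intro allI impI)
  fix \<epsilon> :: real assume "\<epsilon> > 0"
  then obtain \<delta> where d: "\<delta> > 0" "\<And>r x. r \<in> S \<Longrightarrow> \<bar>r - (t - s)\<bar> < \<delta> \<Longrightarrow> x \<in> SU2 \<Longrightarrow>
      \<bar>u r x - u (t - s) x - (r - (t - s)) * u' x\<bar> \<le> \<epsilon> * \<bar>r - (t - s)\<bar>"
    using has_unif_derivD[OF assms] by metis
  show "\<exists>\<delta>>0. \<forall>r\<in>{r. t - r \<in> S}. \<bar>r - s\<bar> < \<delta> \<longrightarrow>
      (\<forall>x\<in>SU2. \<bar>u (t - r) x - u (t - s) x - (r - s) * - u' x\<bar> \<le> \<epsilon> * \<bar>r - s\<bar>)"
  proof (intro exI conjI ballI impI)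
    fix r x assume "r \<in> {r. t - r \<in> S}" "\<bar>r - s\<bar> < \<delta>" "x \<in> SU2"
    moreover have "\<bar>(t - r) - (t - s)\<bar> = \<bar>r - s\<bar>" "(t - r) - (t - s) = - (r - s)" by simp_all
    ultimately have "\<bar>u (t - r) x - u (t - s) x - - (r - s) * u' x\<bar> \<le> \<epsilon> * \<bar>r - s\<bar>"
      using d(2)[of "t - r" x] by (simp only: mem_Collect_eq)
    then show "\<bar>u (t - r) x - u (t - s) x - (r - s) * - u' x\<bar> \<le> \<epsilon> * \<bar>r - s\<bar>"
      by (simp only: mult_minus_left mult_minus_right)
  qed (rule d(1))
qed

lemma has_unif_deriv_mult:
  assumes u: "has_unif_deriv u u' s S" and v: "has_unif_deriv v v' s S"
    and c: "continuous_on SU2 (u s)" "continuous_on SU2 u'" "continuous_on SU2 (v s)" "continuous_on SU2 v'"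
  shows "has_unif_deriv (\<lambda>r x. u r x * v r x) (\<lambda>x. u' x * v s x + u s x * v' x) s S"
  unfolding has_unif_deriv_def
proof (intro allI impI)
  fix \<epsilon> :: real assume e: "\<epsilon> > 0"
  obtain A where A: "A \<ge> 0" "\<And>x. x \<in> SU2 \<Longrightarrow> \<bar>u s x\<bar> \<le> A" using continuous_on_SU2_bounded[OF c(1)] by metis
  obtain A' where A': "A' \<ge> 0" "\<And>x. x \<in> SU2 \<Longrightarrow> \<bar>u' x\<bar> \<le> A'" using continuous_on_SU2_bounded[OF c(2)] by metis
  obtain B where B: "B \<ge> 0" "\<And>x. x \<in> SU2 \<Longrightarrow> \<bar>v s x\<bar> \<le> B" using continuous_on_SU2_bounded[OF c(3)] by metis
  obtain B' where B': "B' \<ge> 0" "\<And>x. x \<in> SU2 \<Longrightarrow> \<bar>v' x\<bar> \<le> B'" using continuous_on_SU2_bounded[OF c(4)] by metis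
  define \<eta> where "\<eta> = \<epsilon> / (2 * (A + B + 1))"
  have eta: "\<eta> > 0" "\<eta> * (A + B) \<le> \<epsilon> / 2" using e A B by (auto simp: \<eta>_def field_simps)
  obtain d1 where d1: "d1 > 0" "\<And>r x. r \<in> S \<Longrightarrow> \<bar>r - s\<bar> < d1 \<Longrightarrow> x \<in> SU2 \<Longrightarrow>
      \<bar>u r x - u s x - (r - s) * u' x\<bar> \<le> \<eta> * \<bar>r - s\<bar>"
    using has_unif_derivD[OF u eta(1)] by metis
  obtain d2 where d2: "d2 > 0" "\<And>r x. r \<in> S \<Longrightarrow> \<bar>r - s\<bar> < d2 \<Longrightarrow> x \<in> SU2 \<Longrightarrow>
      \<bar>v r x - v s x - (r - s) * v' x\<bar> \<le> \<eta> * \<bar>r - s\<bar>"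
    using has_unif_derivD[OF v eta(1)] by metis
  define K where "K = (A' + \<eta>) * (B' + \<eta>)"
  have K: "K \<ge> 0" using A' B' eta by (simp add: K_def)
  define d3 where "d3 = \<epsilon> / (2 * (K + 1))"
  have d3: "d3 > 0" using e K by (simp add: d3_def)
  show "\<exists>\<delta>>0. \<forall>r\<in>S. \<bar>r - s\<bar> < \<delta> \<longrightarrow>
      (\<forall>x\<in>SU2. \<bar>u r x * v r x - u s x * v s x - (r - s) * (u' x * v s x + u s x * v' x)\<bar> \<le> \<epsilon> * \<bar>r - s\<bar>)"
  proof (intro exI[of _ "min d1 (min d2 d3)"] conjI ballI impI)
    fix r x assume r: "r \<in> S" "\<bar>r - s\<bar> < min d1 (min d2 d3)" and x: "x \<in> SU2"
    define h where "h = \<bar>r - s\<bar>"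
    have h: "h \<ge> 0" "h < d3" using r by (auto simp: h_def)
    define p where "p = u r x - u s x - (r - s) * u' x"
    define q where "q = v r x - v s x - (r - s) * v' x"
    have p: "\<bar>p\<bar> \<le> \<eta> * h" using d1(2)[OF r(1) _ x] r(2) by (simp add: p_def h_def)
    have q: "\<bar>q\<bar> \<le> \<eta> * h" using d2(2)[OF r(1) _ x] r(2) by (simp add: q_def h_def)
    have 1: "\<bar>p * v s x\<bar> \<le> \<eta> * h * B"
      unfolding abs_mult using p B x eta h by (intro mult_mono) auto
    have 2: "\<bar>u s x * q\<bar> \<le> A * (\<eta> * h)"
      unfolding abs_mult using q A x eta h by (intro mult_mono) auto
    have "\<bar>u r x - u s x\<bar> \<le> \<bar>p\<bar> + h * \<bar>u' x\<bar>"
      unfolding p_def h_def using abs_triangle_ineq[of "u r x - u s x - (r - s) * u' x" "(r - s) * u' x"]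
      by (simp add: abs_mult)
    also have "\<dots> \<le> h * (A' + \<eta>)"
      using p mult_left_mono[OF A'(2)[OF x] h(1)] by (simp add: algebra_simps)
    finally have 3: "\<bar>u r x - u s x\<bar> \<le> h * (A' + \<eta>)" .
    have "\<bar>v r x - v s x\<bar> \<le> \<bar>q\<bar> + h * \<bar>v' x\<bar>"
      unfolding q_def h_def using abs_triangle_ineq[of "v r x - v s x - (r - s) * v' x" "(r - s) * v' x"]
      by (simp add: abs_mult)
    also have "\<dots> \<le> h * (B' + \<eta>)"
      using q mult_left_mono[OF B'(2)[OF x] h(1)] by (simp add: algebra_simps)
    finally have 4: "\<bar>v r x - v s x\<bar> \<le> h * (B' + \<eta>)" .
    have "\<bar>(u r x - u s x) * (v r x - v s x)\<bar> \<le> (h * (A' + \<eta>)) * (h * (B' + \<eta>))"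
      unfolding abs_mult using 3 4 h A' B' eta by (intro mult_mono) auto
    also have "\<dots> = h * (K * h)" by (simp add: K_def algebra_simps)
    also have "\<dots> \<le> h * (\<epsilon> / 2)"
    proof (intro mult_left_mono h(1))
      have "K * h \<le> (K + 1) * d3" using K h by (intro mult_mono) auto
      also have "\<dots> = \<epsilon> / 2" using K by (simp add: d3_def field_simps)
      finally show "K * h \<le> \<epsilon> / 2" .
    qed
    finally have 5: "\<bar>(u r x - u s x) * (v r x - v s x)\<bar> \<le> h * (\<epsilon> / 2)" .
    have 6: "h * (\<eta> * (A + B)) \<le> h * (\<epsilon> / 2)" using eta h by (intro mult_left_mono) auto
    \<comment> \<open>The first two terms are of size \<open>\<eta> h\<close>; the last one is quadratic in \<open>h\<close>.\<close>
    have "u r x * v r x - u s x * v s x - (r - s) * (u' x * v s x + u s x * v' x) =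
        p * v s x + u s x * q + (u r x - u s x) * (v r x - v s x)"
      by (simp add: p_def q_def algebra_simps)
    then have "\<bar>u r x * v r x - u s x * v s x - (r - s) * (u' x * v s x + u s x * v' x)\<bar> \<le>
        \<bar>p * v s x\<bar> + \<bar>u s x * q\<bar> + \<bar>(u r x - u s x) * (v r x - v s x)\<bar>"
      by linarith
    also have "\<dots> \<le> \<eta> * h * B + A * (\<eta> * h) + h * (\<epsilon> / 2)" using 1 2 5 by linarith
    also have "\<dots> = h * (\<eta> * (A + B)) + h * (\<epsilon> / 2)" by (simp add: algebra_simps)
    also have "\<dots> \<le> \<epsilon> * h" using 6 by (simp add: mult.commute)
    finally show "\<bar>u r x * v r x - u s x * v s x - (r - s) * (u' x * v s x + u s x * v' x)\<bar> \<le> \<epsilon> * \<bar>r - s\<bar>"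
      by (simp add: h_def)
  qed (use d1 d2 d3 in auto)
qed

lemma (in haar) has_unif_deriv_integral:
  assumes u: "has_unif_deriv u u' s S" and s: "s \<in> S"
    and c: "\<And>r. r \<in> S \<Longrightarrow> continuous_on SU2 (u r)" "continuous_on SU2 u'"
  shows "((\<lambda>r. \<integral>x. u r x \<partial>\<mu>) has_real_derivative (\<integral>x. u' x \<partial>\<mu>)) (at s within S)"
  unfolding has_field_derivative_def has_derivative_within_alt
proof (intro conjI allI impI)
  show "bounded_linear ((*) (\<integral>x. u' x \<partial>\<mu>))" by (rule bounded_linear_mult_right)
  fix e :: real assume "e > 0"
  then obtain \<delta> where d: "\<delta> > 0" "\<And>r x. r \<in> S \<Longrightarrow> \<bar>r - s\<bar> < \<delta> \<Longrightarrow> x \<in> SU2 \<Longrightarrow>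
      \<bar>u r x - u s x - (r - s) * u' x\<bar> \<le> e * \<bar>r - s\<bar>"
    using has_unif_derivD[OF u] by metis
  show "\<exists>d>0. \<forall>y\<in>S. norm (y - s) < d \<longrightarrow>
      norm ((\<integral>x. u y x \<partial>\<mu>) - (\<integral>x. u s x \<partial>\<mu>) - (\<integral>x. u' x \<partial>\<mu>) * (y - s)) \<le> e * norm (y - s)"
  proof (intro exI conjI ballI impI)
    fix r assume r: "r \<in> S" "norm (r - s) < \<delta>"
    have "(\<integral>x. u r x \<partial>\<mu>) - (\<integral>x. u s x \<partial>\<mu>) - (\<integral>x. u' x \<partial>\<mu>) * (r - s) =
        (\<integral>x. u r x - u s x - (r - s) * u' x \<partial>\<mu>)"
      using c s r by (simp add: continuous_integrable)
    also have "\<bar>\<dots>\<bar> \<le> e * \<bar>r - s\<bar>"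
      using d(2)[OF r(1)] r(2) \<open>e > 0\<close> by (intro abs_integral_le) auto
    finally show "norm ((\<integral>x. u r x \<partial>\<mu>) - (\<integral>x. u s x \<partial>\<mu>) - (\<integral>x. u' x \<partial>\<mu>) * (r - s)) \<le> e * norm (r - s)"
      by simp
  qed (rule d(1))
qed

lemma field_continuous:
  "E \<in> {eX, eY} \<Longrightarrow> smooth_on_SU2 f \<Longrightarrow> continuous_on SU2 (left_inv_field E f)"
  by (intro smooth_on_SU2_imp_continuous_on smooth_on_SU2_field)

lemma rot_SU2_mult: "E \<in> {eX, eY} \<Longrightarrow> g \<in> SU2 \<Longrightarrow> g ** rot E s \<in> SU2"
  by (intro SU2_mult rot_in_SU2)

text \<open>By the mean value theorem the difference quotients of a smooth function along a
  one-parameter subgroup are values of its derivative, which is uniformly continuous.\<close>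

lemma has_unif_deriv_along_rot:
  assumes E: "E \<in> {eX, eY}" and f: "smooth_on_SU2 f"
  shows "has_unif_deriv (\<lambda>s x. f (x ** rot E s)) (left_inv_field E f) 0 UNIV"
  unfolding has_unif_deriv_def
proof (intro allI impI)
  fix \<epsilon> :: real assume e: "\<epsilon> > 0"
  let ?Ef = "left_inv_field E f"
  let ?K = "SU2 \<times> {-1..1::real}"
  have "continuous_on ?K (\<lambda>z. ?Ef (fst z ** rot E (snd z)))"
  proof (rule continuous_on_compose2[OF field_continuous[OF E f]])
    show "continuous_on ?K (\<lambda>z. fst z ** rot E (snd z))"
      unfolding rot_def by (intro continuous_intros)
  qed (auto simp: rot_SU2_mult[OF E])
  then have "uniformly_continuous_on ?K (\<lambda>z. ?Ef (fst z ** rot E (snd z)))"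
    by (intro compact_uniformly_continuous compact_Times compact_SU2 compact_Icc)
  then obtain d where d: "d > 0" "\<And>z z'. z \<in> ?K \<Longrightarrow> z' \<in> ?K \<Longrightarrow> dist z' z < d \<Longrightarrow>
      dist (?Ef (fst z' ** rot E (snd z'))) (?Ef (fst z ** rot E (snd z))) < \<epsilon>"
    using e unfolding uniformly_continuous_on_def by metis
  show "\<exists>\<delta>>0. \<forall>r\<in>UNIV. \<bar>r - 0\<bar> < \<delta> \<longrightarrow>
      (\<forall>x\<in>SU2. \<bar>f (x ** rot E r) - f (x ** rot E 0) - (r - 0) * ?Ef x\<bar> \<le> \<epsilon> * \<bar>r - 0\<bar>)"
  proof (intro exI[of _ "min d 1"] conjI ballI impI)
    fix r x assume r: "\<bar>r - 0\<bar> < min d 1" and x: "x \<in> SU2"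
    let ?\<psi> = "\<lambda>r. f (x ** rot E r) - r * ?Ef x"
    have "norm (?\<psi> r - ?\<psi> 0) \<le> \<epsilon> * norm (r - 0)"
    proof (rule field_differentiable_bound)
      show "convex (closed_segment 0 r)" by (rule convex_closed_segment)
      fix z assume z: "z \<in> closed_segment 0 r"
      have z1: "\<bar>z\<bar> \<le> \<bar>r\<bar>" using z by (auto simp: closed_segment_eq_real_ivl split: if_splits)
      show "(?\<psi> has_field_derivative ?Ef (x ** rot E z) - ?Ef x) (at z within closed_segment 0 r)"
        using has_derivative_along_rot[OF E f x, of z]
        by (auto intro!: derivative_eq_intros intro: has_field_derivative_at_within)
      show "norm (?Ef (x ** rot E z) - ?Ef x) \<le> \<epsilon>"
      proof -
        have "- 1 \<le> z" "z \<le> 1" "\<bar>z\<bar> < d" using z1 r by auto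
        then show ?thesis
          using d(2)[of "(x, 0)" "(x, z)"] x by (simp add: dist_Pair_Pair dist_norm)
      qed
    qed auto
    then show "\<bar>f (x ** rot E r) - f (x ** rot E 0) - (r - 0) * ?Ef x\<bar> \<le> \<epsilon> * \<bar>r - 0\<bar>"
      by simp
  qed (use d in auto)
qed

section \<open>Integration by parts\<close>

lemma field_mult:
  assumes E: "E \<in> {eX, eY}" and f: "smooth_on_SU2 f" and h: "smooth_on_SU2 h" and x: "x \<in> SU2"
  shows "left_inv_field E (\<lambda>x. f x * h x) x = left_inv_field E f x * h x + f x * left_inv_field E h x"
proof -
  have "((\<lambda>s. f (x ** rot E s) * h (x ** rot E s)) has_real_derivative
      left_inv_field E f x * h x + f x * left_inv_field E h x) (at 0)"
    using DERIV_mult[OF has_derivative_along_rot[OF E f x, of 0] has_derivative_along_rot[OF E h x, of 0]]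
    by (simp add: mult.commute add.commute)
  then show ?thesis unfolding field_eq_rot[OF E] by (rule DERIV_imp_deriv)
qed

context haar
begin

text \<open>The integral of \<open>f(x exp (s E))\<close> is independent of \<open>s\<close> by right invariance.\<close>

lemma integral_field_eq_0:
  assumes E: "E \<in> {eX, eY}" and f: "smooth_on_SU2 f"
  shows "(\<integral>x. left_inv_field E f x \<partial>\<mu>) = 0"
proof -
  have c: "continuous_on SU2 (\<lambda>x. f (x ** rot E s))" for s
    by (intro continuous_on_SU2_compose[OF smooth_on_SU2_imp_continuous_on[OF f]]
        continuous_on_linear linear_matrix_mult_right rot_SU2_mult E)
  have "((\<lambda>s. \<integral>x. f (x ** rot E s) \<partial>\<mu>) has_real_derivative (\<integral>x. left_inv_field E f x \<partial>\<mu>)) (at 0 within UNIV)"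
    by (intro has_unif_deriv_integral has_unif_deriv_along_rot E f c field_continuous UNIV_I)
  moreover have "(\<lambda>s. \<integral>x. f (x ** rot E s) \<partial>\<mu>) = (\<lambda>s. integral\<^sup>L \<mu> f)"
    by (intro ext integral_right_translate rot_in_SU2 E smooth_on_SU2_imp_continuous_on f)
  ultimately show ?thesis using DERIV_unique DERIV_const by metis
qed

lemma integral_field_by_parts:
  assumes E: "E \<in> {eX, eY}" and f: "smooth_on_SU2 f" and h: "smooth_on_SU2 h"
  shows "(\<integral>x. left_inv_field E f x * h x \<partial>\<mu>) = - (\<integral>x. f x * left_inv_field E h x \<partial>\<mu>)"
proof -
  note [continuous_intros] = field_continuous[OF E] smooth_on_SU2_imp_continuous_on
  have "0 = (\<integral>x. left_inv_field E (\<lambda>x. f x * h x) x \<partial>\<mu>)"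
    using integral_field_eq_0[OF E smooth_on_SU2_mult[OF f h]] by simp
  also have "\<dots> = (\<integral>x. left_inv_field E f x * h x + f x * left_inv_field E h x \<partial>\<mu>)"
    by (intro integral_cong_SU2 field_mult E f h)
  also have "\<dots> = (\<integral>x. left_inv_field E f x * h x \<partial>\<mu>) + (\<integral>x. f x * left_inv_field E h x \<partial>\<mu>)"
    using f h by (intro Bochner_Integration.integral_add continuous_integrable continuous_intros)
  finally show ?thesis by simp
qed

lemma integral_sublaplacian_mult:
  assumes f: "smooth_on_SU2 f" and h: "smooth_on_SU2 h"
  shows "(\<integral>x. sublaplacian f x * h x \<partial>\<mu>) = - (\<integral>x. carre_du_champ f h x \<partial>\<mu>)"
proof -
  have int: "integrable \<mu> (\<lambda>x. left_inv_field E (left_inv_field E f) x * h x)"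
    "integrable \<mu> (\<lambda>x. left_inv_field E f x * left_inv_field E h x)" if "E \<in> {eX, eY}" for E
    using that f h
    by (intro continuous_integrable smooth_on_SU2_imp_continuous_on smooth_on_SU2_mult
        smooth_on_SU2_field; simp)+
  have "(\<integral>x. sublaplacian f x * h x \<partial>\<mu>) =
      (\<integral>x. left_inv_field eX (left_inv_field eX f) x * h x \<partial>\<mu>) +
      (\<integral>x. left_inv_field eY (left_inv_field eY f) x * h x \<partial>\<mu>)"
    using int by (simp add: sublaplacian_def field_X_eq field_Y_eq distrib_right)
  also have "\<dots> = - (\<integral>x. carre_du_champ f h x \<partial>\<mu>)"
    using int f h by (simp add: integral_field_by_parts smooth_on_SU2_field
        carre_du_champ_def field_X_eq field_Y_eq)
  finally show ?thesis .
qed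

lemma integral_sublaplacian_symmetric:
  assumes f: "smooth_on_SU2 f" and h: "smooth_on_SU2 h"
  shows "(\<integral>x. sublaplacian f x * h x \<partial>\<mu>) = (\<integral>x. f x * sublaplacian h x \<partial>\<mu>)"
proof -
  have "(\<integral>x. carre_du_champ f h x \<partial>\<mu>) = (\<integral>x. carre_du_champ h f x \<partial>\<mu>)"
    by (simp add: carre_du_champ_def mult.commute)
  then show ?thesis
    using integral_sublaplacian_mult[OF f h] integral_sublaplacian_mult[OF h f]
    by (simp add: mult.commute)
qed

end

section \<open>Functions with a one-sided derivative\<close>

text \<open>Right derivatives suffice for the mean value inequality.  If it failed with slope \<open>M + \<eta>\<close>, then
  at the last point of \<open>[a, b]\<close> where it still holds the right derivative would keep it valid a little
  further.\<close>

lemma right_derivative_le_imp_increment_le: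
  fixes \<phi> d :: "real \<Rightarrow> real"
  assumes "a \<le> b" and c: "continuous_on {a..b} \<phi>"
    and d: "\<And>s. a \<le> s \<Longrightarrow> s < b \<Longrightarrow> ((\<lambda>r. (\<phi> (s + r) - \<phi> s) / r) \<longlongrightarrow> d s) (at_right 0)"
    and M: "\<And>s. a \<le> s \<Longrightarrow> s < b \<Longrightarrow> d s \<le> M"
  shows "\<phi> b - \<phi> a \<le> M * (b - a)"
proof (rule field_le_epsilon)
  fix e :: real assume "e > 0"
  define \<eta> where "\<eta> = e / (b - a + 1)"
  have eta: "\<eta> > 0" "\<eta> * (b - a) \<le> e" using \<open>e > 0\<close> \<open>a \<le> b\<close> by (auto simp: \<eta>_def field_simps)
  define \<psi> where "\<psi> s = \<phi> s - \<phi> a - (M + \<eta>) * (s - a)" for s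
  have c\<psi>: "continuous_on {a..b} \<psi>" unfolding \<psi>_def by (intro continuous_intros c)
  have "\<psi> b \<le> 0"
  proof (rule ccontr)
    assume neg: "\<not> \<psi> b \<le> 0"
    let ?S = "{s \<in> {a..b}. \<psi> s \<le> 0}"
    have "closed ?S"
    proof -
      have "?S = {a..b} \<inter> \<psi> -` {..0}" by auto
      then show ?thesis
        using continuous_closed_preimage[OF c\<psi> closed_atLeastAtMost closed_atMost[of 0]] by metis
    qed
    moreover have "bounded ?S" by (rule bounded_subset[OF bounded_closed_interval[of a b]]) auto
    ultimately have cp: "compact ?S" by (simp add: compact_eq_bounded_closed)
    have "a \<in> ?S" using \<open>a \<le> b\<close> by (simp add: \<psi>_def)
    with compact_attains_sup[OF cp] obtain s where s: "s \<in> ?S" "\<And>r. r \<in> ?S \<Longrightarrow> r \<le> s" by blast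
    have sb: "a \<le> s" "s < b" using s neg by (auto simp: le_less)
    have "((\<lambda>r. (\<phi> (s + r) - \<phi> s) / r) \<longlongrightarrow> d s) (at_right 0)" by (rule d[OF sb])
    then have "\<forall>\<^sub>F r in at_right 0. (\<phi> (s + r) - \<phi> s) / r < M + \<eta>"
      by (rule order_tendstoD) (use M[OF sb] eta in simp)
    then obtain \<delta> where del: "\<delta> > 0" "\<And>r. 0 < r \<Longrightarrow> r < \<delta> \<Longrightarrow> (\<phi> (s + r) - \<phi> s) / r < M + \<eta>"
      unfolding eventually_at_right_field by auto
    define r where "r = min (\<delta> / 2) (b - s)"
    have r: "0 < r" "r < \<delta>" "s + r \<le> b" using del sb by (auto simp: r_def)
    have "\<phi> (s + r) - \<phi> s < (M + \<eta>) * r" using del(2)[OF r(1,2)] r(1) by (simp add: field_simps)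
    then have "\<psi> (s + r) < \<psi> s" by (simp add: \<psi>_def algebra_simps)
    then have "s + r \<in> ?S" using s(1) r sb by auto
    from s(2)[OF this] r(1) show False by simp
  qed
  then have "\<phi> b - \<phi> a \<le> (M + \<eta>) * (b - a)" by (simp add: \<psi>_def)
  also have "\<dots> = M * (b - a) + \<eta> * (b - a)" by (simp add: algebra_simps)
  also have "\<dots> \<le> M * (b - a) + e" using eta by simp
  finally show "\<phi> b - \<phi> a \<le> M * (b - a) + e" .
qed

lemma right_derivative_close_imp_increment_close:
  fixes \<phi> d :: "real \<Rightarrow> real"
  assumes "a \<le> b" and c: "continuous_on {a..b} \<phi>"
    and d: "\<And>s. a \<le> s \<Longrightarrow> s < b \<Longrightarrow> ((\<lambda>r. (\<phi> (s + r) - \<phi> s) / r) \<longlongrightarrow> d s) (at_right 0)"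
    and e: "\<And>s. a \<le> s \<Longrightarrow> s < b \<Longrightarrow> \<bar>d s - c'\<bar> \<le> \<epsilon>"
  shows "\<bar>\<phi> b - \<phi> a - (b - a) * c'\<bar> \<le> \<epsilon> * (b - a)"
proof -
  have 1: "\<phi> b - \<phi> a \<le> (c' + \<epsilon>) * (b - a)"
  proof (rule right_derivative_le_imp_increment_le[OF \<open>a \<le> b\<close> c d])
    show "d s \<le> c' + \<epsilon>" if "a \<le> s" "s < b" for s using e[OF that] by linarith
  qed
  have "- \<phi> b - - \<phi> a \<le> (- c' + \<epsilon>) * (b - a)"
  proof (rule right_derivative_le_imp_increment_le[where d = "\<lambda>s. - d s", OF \<open>a \<le> b\<close>])
    show "continuous_on {a..b} (\<lambda>s. - \<phi> s)" by (intro continuous_on_minus c)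
    fix s assume s: "a \<le> s" "s < b"
    show "((\<lambda>r. (- \<phi> (s + r) - - \<phi> s) / r) \<longlongrightarrow> - d s) (at_right 0)"
      using tendsto_minus[OF d[OF s]] by (simp add: minus_divide_left)
    show "- d s \<le> - c' + \<epsilon>" using e[OF s] by linarith
  qed
  with 1 show ?thesis by (simp add: abs_le_iff algebra_simps)
qed

section \<open>The closure of the sublaplacian\<close>

lemma uniform_limit_imp_continuous:
  assumes "\<And>n. continuous_on SU2 (\<phi> n)" "uniform_limit SU2 \<phi> f sequentially"
  shows "continuous_on SU2 f"
proof (rule uniform_limit_theorem[OF _ assms(2)])
  show "\<forall>\<^sub>F n in sequentially. continuous_on SU2 (\<phi> n)"
    by (intro always_eventually allI assms(1))
qed simp

lemma smooth_on_SU2_sublaplacian: "smooth_on_SU2 f \<Longrightarrow> smooth_on_SU2 (sublaplacian f)"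
  unfolding sublaplacian_def[abs_def] field_X_eq field_Y_eq
  by (intro smooth_on_SU2_add smooth_on_SU2_field) auto

lemma smooth_imp_closure_graph: "smooth_on_SU2 f \<Longrightarrow> sublaplacian_closure_graph f (sublaplacian f)"
  unfolding sublaplacian_closure_graph_def
  by (intro exI[of _ "\<lambda>n. f"]) (auto intro: uniform_limit_const)

lemma (in haar) integral_uniform_limit_mult:
  fixes u v :: "nat \<Rightarrow> cmat2 \<Rightarrow> real"
  assumes u: "\<And>n. continuous_on SU2 (u n)" "uniform_limit SU2 u f sequentially"
    and v: "\<And>n. continuous_on SU2 (v n)" "uniform_limit SU2 v h sequentially"
  shows "(\<lambda>n. \<integral>x. u n x * v n x \<partial>\<mu>) \<longlonglongrightarrow> (\<integral>x. f x * h x \<partial>\<mu>)"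
proof (rule LIMSEQ_I)
  fix e :: real assume e: "e > 0"
  have cf: "continuous_on SU2 f" and ch: "continuous_on SU2 h"
    using uniform_limit_imp_continuous[OF u] uniform_limit_imp_continuous[OF v] by blast+
  note b = compact_imp_bounded[OF compact_continuous_image[OF _ compact_SU2]]
  have "uniform_limit SU2 (\<lambda>n x. u n x * v n x) (\<lambda>x. f x * h x) sequentially"
    by (intro uniform_lim_mult u(2) v(2) b cf ch)
  then obtain N where N: "\<And>n x. n \<ge> N \<Longrightarrow> x \<in> SU2 \<Longrightarrow> dist (u n x * v n x) (f x * h x) < e / 2"
    using e unfolding uniform_limit_sequentially_iff by (meson half_gt_zero)
  show "\<exists>N. \<forall>n\<ge>N. norm ((\<integral>x. u n x * v n x \<partial>\<mu>) - (\<integral>x. f x * h x \<partial>\<mu>)) < e"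
  proof (intro exI allI impI)
    fix n assume n: "n \<ge> N"
    have "(\<integral>x. u n x * v n x \<partial>\<mu>) - (\<integral>x. f x * h x \<partial>\<mu>) = (\<integral>x. u n x * v n x - f x * h x \<partial>\<mu>)"
      by (intro Bochner_Integration.integral_diff[symmetric] continuous_integrable continuous_on_mult
          cf ch u(1) v(1))
    also have "\<bar>\<dots>\<bar> \<le> e / 2"
      using N[OF n] e by (intro abs_integral_le) (auto simp: dist_norm intro: less_imp_le)
    finally show "norm ((\<integral>x. u n x * v n x \<partial>\<mu>) - (\<integral>x. f x * h x \<partial>\<mu>)) < e" using e by simp
  qed
qed

text \<open>Linearity of \<open>T\<close> on the ambient matrix space serves to preserve smoothness.\<close>

definition sublaplacian_symmetry :: "(cmat2 \<Rightarrow> cmat2) \<Rightarrow> bool" where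
  "sublaplacian_symmetry T \<longleftrightarrow> linear T \<and> (\<forall>x\<in>SU2. T x \<in> SU2) \<and>
     (\<forall>\<phi>. smooth_on_SU2 \<phi> \<longrightarrow>
        (\<forall>x\<in>SU2. sublaplacian (\<lambda>y. \<phi> (T y)) x = sublaplacian \<phi> (T x)))"

lemma sublaplacian_symmetry_id: "sublaplacian_symmetry (\<lambda>x. x)"
  by (simp add: sublaplacian_symmetry_def linear_iff)

lemma uniform_limit_compose_map:
  "uniform_limit SU2 u f F \<Longrightarrow> \<forall>x\<in>SU2. T x \<in> SU2 \<Longrightarrow>
    uniform_limit SU2 (\<lambda>n x. u n (T x)) (\<lambda>x. f (T x)) F"
  unfolding uniform_limit_iff by (fast elim: eventually_mono)

lemma (in haar) closure_graph_symmetric: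
  assumes T: "sublaplacian_symmetry T"
    and "sublaplacian_closure_graph f h" "sublaplacian_closure_graph k w"
  shows "(\<integral>x. h (T x) * k x \<partial>\<mu>) = (\<integral>x. f (T x) * w x \<partial>\<mu>)"
proof -
  obtain \<phi> where \<phi>: "\<And>n::nat. smooth_on_SU2 (\<phi> n)" "uniform_limit SU2 \<phi> f sequentially"
    "uniform_limit SU2 (\<lambda>n. sublaplacian (\<phi> n)) h sequentially"
    using assms(2) unfolding sublaplacian_closure_graph_def by blast
  obtain \<psi> where \<psi>: "\<And>n::nat. smooth_on_SU2 (\<psi> n)" "uniform_limit SU2 \<psi> k sequentially"
    "uniform_limit SU2 (\<lambda>n. sublaplacian (\<psi> n)) w sequentially"
    using assms(3) unfolding sublaplacian_closure_graph_def by blast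
  have T1: "linear T" "\<forall>x\<in>SU2. T x \<in> SU2"
    and T2: "\<And>\<phi> x. smooth_on_SU2 \<phi> \<Longrightarrow> x \<in> SU2 \<Longrightarrow> sublaplacian (\<lambda>y. \<phi> (T y)) x = sublaplacian \<phi> (T x)"
    using T unfolding sublaplacian_symmetry_def by blast+
  have sT: "smooth_on_SU2 (\<lambda>x. u (T x))" if "smooth_on_SU2 u" for u
    using T1(2) by (intro smooth_on_SU2_compose_linear[OF T1(1) _ that]) blast
  note s\<phi> = sT[OF \<phi>(1)] and s\<phi>' = sT[OF smooth_on_SU2_sublaplacian[OF \<phi>(1)]]
    and s\<psi> = smooth_on_SU2_sublaplacian[OF \<psi>(1)]
  note c = smooth_on_SU2_imp_continuous_on
  note l\<phi> = uniform_limit_compose_map[OF \<phi>(2) T1(2)] and l\<phi>' = uniform_limit_compose_map[OF \<phi>(3) T1(2)]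
  have "(\<lambda>n. \<integral>x. sublaplacian (\<phi> n) (T x) * \<psi> n x \<partial>\<mu>) \<longlonglongrightarrow> (\<integral>x. h (T x) * k x \<partial>\<mu>)"
    by (rule integral_uniform_limit_mult[OF c[OF s\<phi>'] l\<phi>' c[OF \<psi>(1)] \<psi>(2)])
  moreover have "(\<integral>x. sublaplacian (\<phi> n) (T x) * \<psi> n x \<partial>\<mu>) = (\<integral>x. \<phi> n (T x) * sublaplacian (\<psi> n) x \<partial>\<mu>)" for n
  proof -
    have "(\<integral>x. sublaplacian (\<phi> n) (T x) * \<psi> n x \<partial>\<mu>) =
        (\<integral>x. sublaplacian (\<lambda>y. \<phi> n (T y)) x * \<psi> n x \<partial>\<mu>)"
      by (intro integral_cong_SU2) (simp add: T2 \<phi>)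
    also have "\<dots> = (\<integral>x. \<phi> n (T x) * sublaplacian (\<psi> n) x \<partial>\<mu>)"
      by (rule integral_sublaplacian_symmetric[OF s\<phi> \<psi>(1)])
    finally show ?thesis .
  qed
  moreover have "(\<lambda>n. \<integral>x. \<phi> n (T x) * sublaplacian (\<psi> n) x \<partial>\<mu>) \<longlonglongrightarrow> (\<integral>x. f (T x) * w x \<partial>\<mu>)"
    by (rule integral_uniform_limit_mult[OF c[OF s\<phi>] l\<phi> c[OF s\<psi>] \<psi>(3)])
  ultimately show ?thesis using LIMSEQ_unique by simp
qed

text \<open>Polynomials in the matrix entries are smooth, so smooth functions are dense in \<open>C(SU2)\<close> by the
  Stone-Weierstrass theorem.\<close>

lemma smooth_on_SU2_polynomial: "real_polynomial_function f \<Longrightarrow> smooth_on_SU2 f"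
proof (induction rule: real_polynomial_function.induct)
  case (linear f)
  then have "Ck_on k f UNIV" for k by (intro Ck_on_linear bounded_linear.linear)
  then show ?case unfolding smooth_on_SU2_def using open_UNIV by blast
qed (intro smooth_on_SU2_const smooth_on_SU2_add smooth_on_SU2_mult; assumption)+

lemma continuous_is_uniform_limit_of_smooth:
  assumes "continuous_on SU2 u"
  obtains \<phi> where "\<And>n::nat. smooth_on_SU2 (\<phi> n)" "uniform_limit SU2 \<phi> u sequentially"
proof -
  have "\<exists>v. smooth_on_SU2 v \<and> (\<forall>x\<in>SU2. \<bar>u x - v x\<bar> < inverse (real (Suc n)))" for n
    using Stone_Weierstrass_real_polynomial_function[OF compact_SU2 assms, of "inverse (real (Suc n))"]
      smooth_on_SU2_polynomial by (metis inverse_positive_iff_positive of_nat_0_less_iff zero_less_Suc)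
  then obtain \<phi> where \<phi>: "\<And>n. smooth_on_SU2 (\<phi> n)" "\<And>n x. x \<in> SU2 \<Longrightarrow> \<bar>u x - \<phi> n x\<bar> < inverse (real (Suc n))"
    by metis
  have "uniform_limit SU2 \<phi> u sequentially"
    unfolding uniform_limit_sequentially_iff
  proof (intro allI impI)
    fix e :: real assume "e > 0"
    then obtain N where N: "inverse (real (Suc N)) < e" using reals_Archimedean by blast
    show "\<exists>N. \<forall>n\<ge>N. \<forall>x\<in>SU2. dist (\<phi> n x) (u x) < e"
    proof (intro exI allI impI ballI)
      fix n x assume "n \<ge> N" "x \<in> SU2"
      then have "inverse (real (Suc n)) \<le> inverse (real (Suc N))" by (simp add: le_imp_inverse_le)
      with \<phi>(2)[OF \<open>x \<in> SU2\<close>, of n] N have "\<bar>u x - \<phi> n x\<bar> < e" by linarith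
      then show "dist (\<phi> n x) (u x) < e" by (simp add: dist_real_def abs_minus_commute)
    qed
  qed
  with \<phi>(1) show thesis by (rule that)
qed

text \<open>By density the tests may be taken to approach \<open>u\<close> itself, so \<open>u\<^sup>2\<close> has integral zero, and Haar
  measure has full support.\<close>

lemma (in haar) orthogonal_to_smooth_imp_0:
  assumes c: "continuous_on SU2 u"
    and 0: "\<And>k. smooth_on_SU2 k \<Longrightarrow> (\<integral>x. u x * k x \<partial>\<mu>) = 0" and "x \<in> SU2"
  shows "u x = 0"
proof (rule integral_square_eq_0_imp[OF c _ \<open>x \<in> SU2\<close>])
  obtain \<phi> where \<phi>: "\<And>n::nat. smooth_on_SU2 (\<phi> n)" "uniform_limit SU2 \<phi> u sequentially"
    using continuous_is_uniform_limit_of_smooth[OF c] by blast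
  have "(\<lambda>n. \<integral>x. u x * \<phi> n x \<partial>\<mu>) \<longlonglongrightarrow> (\<integral>x. u x * u x \<partial>\<mu>)"
    by (rule integral_uniform_limit_mult[OF c uniform_limit_const
          smooth_on_SU2_imp_continuous_on[OF \<phi>(1)] \<phi>(2)])
  then have "(\<lambda>n. 0) \<longlonglongrightarrow> (\<integral>x. u x * u x \<partial>\<mu>)" by (simp only: 0[OF \<phi>(1)])
  then show "(\<integral>x. (u x)\<^sup>2 \<partial>\<mu>) = 0"
    unfolding LIMSEQ_const_iff power2_eq_square by (rule sym)
qed

lemma (in haar) eq_on_SU2_if_smooth_tests_agree:
  assumes c: "continuous_on SU2 u" "continuous_on SU2 v"
    and eq: "\<And>k. smooth_on_SU2 k \<Longrightarrow> (\<integral>x. u x * k x \<partial>\<mu>) = (\<integral>x. v x * k x \<partial>\<mu>)" and x: "x \<in> SU2"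
  shows "u x = v x"
proof -
  have "u x - v x = 0"
  proof (rule orthogonal_to_smooth_imp_0[OF _ _ x])
    show "continuous_on SU2 (\<lambda>x. u x - v x)" by (intro continuous_on_diff c)
    fix k assume k: "smooth_on_SU2 k"
    have "(\<integral>x. (u x - v x) * k x \<partial>\<mu>) = (\<integral>x. u x * k x \<partial>\<mu>) - (\<integral>x. v x * k x \<partial>\<mu>)"
      unfolding left_diff_distrib
      by (intro Bochner_Integration.integral_diff continuous_integrable continuous_on_mult c
          smooth_on_SU2_imp_continuous_on k)
    then show "(\<integral>x. (u x - v x) * k x \<partial>\<mu>) = 0" using eq[OF k] by simp
  qed
  then show ?thesis by simp
qed

section \<open>The heat semigroup\<close>

locale heat = haar +
  fixes P :: "real \<Rightarrow> (cmat2 \<Rightarrow> real) \<Rightarrow> cmat2 \<Rightarrow> real"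
  assumes heat: "heat_semigroup P"
begin

lemma C0: "C0_semigroup P"
  using heat unfolding heat_semigroup_def by (rule conjunct1)

lemma graph_iff: "generator_graph P f h \<longleftrightarrow> sublaplacian_closure_graph f h"
  using heat unfolding heat_semigroup_def by blast

lemmas C0_unfolded = C0[unfolded C0_semigroup_def]

lemma P_continuous: "t \<ge> 0 \<Longrightarrow> continuous_on SU2 f \<Longrightarrow> continuous_on SU2 (P t f)"
  by (rule C0_unfolded[THEN conjunct1, rule_format])

lemma P_linear:
  "t \<ge> 0 \<Longrightarrow> continuous_on SU2 f \<Longrightarrow> continuous_on SU2 h \<Longrightarrow> x \<in> SU2 \<Longrightarrow>
    P t (\<lambda>x. a * f x + b * h x) x = a * P t f x + b * P t h x"
  by (rule C0_unfolded[THEN conjunct2, THEN conjunct1, rule_format])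

lemma P_bounded:
  assumes "t \<ge> 0"
  obtains C where "C > 0" "\<And>(f :: cmat2 \<Rightarrow> real) B x. continuous_on SU2 f \<Longrightarrow> (\<And>y. y \<in> SU2 \<Longrightarrow> \<bar>f y\<bar> \<le> B) \<Longrightarrow> x \<in> SU2 \<Longrightarrow> \<bar>P t f x\<bar> \<le> C * B"
proof -
  obtain C where C: "\<And>(f :: cmat2 \<Rightarrow> real) B x. continuous_on SU2 f \<Longrightarrow> (\<And>y. y \<in> SU2 \<Longrightarrow> \<bar>f y\<bar> \<le> B) \<Longrightarrow> x \<in> SU2 \<Longrightarrow> \<bar>P t f x\<bar> \<le> C * B"
    using C0_unfolded[THEN conjunct2, THEN conjunct2, THEN conjunct1, rule_format, OF assms] by blast
  show thesis
  proof (rule that)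
    show "\<bar>C\<bar> + 1 > 0" by simp
    fix f :: "cmat2 \<Rightarrow> real" and B x assume f: "continuous_on SU2 f" "\<And>y. y \<in> SU2 \<Longrightarrow> \<bar>f y\<bar> \<le> B" and x: "x \<in> SU2"
    have "\<bar>P t f x\<bar> \<le> C * B" by (rule C[OF f x])
    also have "\<dots> \<le> (\<bar>C\<bar> + 1) * B"
      using f(2)[OF x] by (intro mult_right_mono) auto
    finally show "\<bar>P t f x\<bar> \<le> (\<bar>C\<bar> + 1) * B" .
  qed
qed

lemma P_0: "continuous_on SU2 f \<Longrightarrow> x \<in> SU2 \<Longrightarrow> P 0 f x = f x"
  by (rule C0_unfolded[THEN conjunct2, THEN conjunct2, THEN conjunct2, THEN conjunct1, rule_format])

lemma P_add: "s \<ge> 0 \<Longrightarrow> t \<ge> 0 \<Longrightarrow> continuous_on SU2 f \<Longrightarrow> x \<in> SU2 \<Longrightarrow> P (s + t) f x = P s (P t f) x"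
  by (rule C0_unfolded[THEN conjunct2, THEN conjunct2, THEN conjunct2, THEN conjunct2, THEN conjunct1, rule_format])

lemma P_strongly_continuous:
  "t \<ge> 0 \<Longrightarrow> continuous_on SU2 f \<Longrightarrow> uniform_limit SU2 (\<lambda>s. P s f) (P t f) (at t within {0..})"
  by (rule C0_unfolded[THEN conjunct2, THEN conjunct2, THEN conjunct2, THEN conjunct2, THEN conjunct2, rule_format])

lemma generator_graph_continuous:
  "generator_graph P f h \<Longrightarrow> continuous_on SU2 f" "generator_graph P f h \<Longrightarrow> continuous_on SU2 h"
  by (auto simp: generator_graph_def)

lemma smooth_generator_graph: "smooth_on_SU2 f \<Longrightarrow> generator_graph P f (sublaplacian f)"
  using graph_iff smooth_imp_closure_graph by blast

text \<open>The difference quotients of \<open>P\<^sub>t f\<close> are the images under the bounded operator \<open>P\<^sub>t\<close> of those of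
  \<open>f\<close>.\<close>

lemma generator_graph_P:
  assumes g: "generator_graph P f h" and t: "t \<ge> 0"
  shows "generator_graph P (P t f) (P t h)"
  unfolding generator_graph_def
proof (intro conjI P_continuous t generator_graph_continuous[OF g])
  note c = generator_graph_continuous[OF g]
  obtain C where C: "C > 0" "\<And>(f :: cmat2 \<Rightarrow> real) B x. continuous_on SU2 f \<Longrightarrow> (\<And>y. y \<in> SU2 \<Longrightarrow> \<bar>f y\<bar> \<le> B) \<Longrightarrow> x \<in> SU2 \<Longrightarrow> \<bar>P t f x\<bar> \<le> C * B"
    using P_bounded[OF t] by metis
  show "uniform_limit SU2 (\<lambda>s x. (P s (P t f) x - P t f x) / s) (P t h) (at_right 0)"
    unfolding uniform_limit_iff
  proof (intro allI impI)
    fix e :: real assume e: "e > 0"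
    define \<eta> where "\<eta> = e / (2 * C)"
    have eta: "\<eta> > 0" "C * \<eta> < e" using C e by (auto simp: \<eta>_def)
    have "\<forall>\<^sub>F s in at_right 0. \<forall>x\<in>SU2. dist ((P s f x - f x) / s) (h x) < \<eta>"
      using g eta(1) unfolding generator_graph_def uniform_limit_iff by blast
    moreover have "\<forall>\<^sub>F s :: real in at_right 0. s > 0" by (rule eventually_at_right_less)
    ultimately show "\<forall>\<^sub>F s in at_right 0. \<forall>x\<in>SU2. dist ((P s (P t f) x - P t f x) / s) (P t h x) < e"
    proof eventually_elim
      fix s :: real assume s: "\<forall>x\<in>SU2. dist ((P s f x - f x) / s) (h x) < \<eta>" "s > 0"
      define q where "q x = (1 / s) * P s f x + (- 1 / s) * f x" for x
      have cs: "continuous_on SU2 (P s f)" using s c by (intro P_continuous) auto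
      then have cq: "continuous_on SU2 q" unfolding q_def by (intro continuous_intros c)
      show "\<forall>x\<in>SU2. dist ((P s (P t f) x - P t f x) / s) (P t h x) < e"
      proof
        fix x assume x: "x \<in> SU2"
        have "P s (P t f) x = P t (P s f) x"
          using P_add[of s t f x] P_add[of t s f x] s t c x by (simp add: add.commute)
        then have "(P s (P t f) x - P t f x) / s = (1 / s) * P t (P s f) x + (- 1 / s) * P t f x"
          by (simp add: diff_divide_distrib)
        also have "\<dots> = P t q x"
          unfolding q_def[abs_def] by (rule P_linear[symmetric, OF t cs c(1) x])
        finally have "(P s (P t f) x - P t f x) / s - P t h x = 1 * P t q x + (- 1) * P t h x" by simp
        also have "\<dots> = P t (\<lambda>x. 1 * q x + (- 1) * h x) x"
          by (rule P_linear[symmetric, OF t cq c(2) x])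
        also have "\<bar>\<dots>\<bar> \<le> C * \<eta>"
        proof (rule C(2)[OF _ _ x])
          show "continuous_on SU2 (\<lambda>x. 1 * q x + (- 1) * h x)" by (intro continuous_intros cq c)
          fix y assume "y \<in> SU2"
          then have "\<bar>(P s f y - f y) / s - h y\<bar> < \<eta>" using s by (simp add: dist_real_def)
          moreover have "1 * q y + (- 1) * h y = (P s f y - f y) / s - h y"
            by (simp add: q_def diff_divide_distrib)
          ultimately show "\<bar>1 * q y + (- 1) * h y\<bar> \<le> \<eta>" by simp
        qed
        finally show "dist ((P s (P t f) x - P t f x) / s) (P t h x) < e"
          using eta by (simp add: dist_real_def)
      qed
    qed
  qed
qed

text \<open>A difference quotient to the left of \<open>s\<close> involves \<open>P\<^sub>r\<close> for varying \<open>r < s\<close>, whose norms are not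
  known to be bounded locally uniformly in \<open>r\<close>.  Instead of deriving such a bound, the proof
  applies the mean value inequality for right derivatives: at each point \<open>x\<close> the function \<open>r \<mapsto> P\<^sub>r f(x)\<close> has the right
  derivative \<open>P\<^sub>r h(x)\<close>, which is close to \<open>P\<^sub>s h(x)\<close> for \<open>r\<close> near \<open>s\<close>, uniformly in \<open>x\<close>.\<close>

lemma P_has_unif_deriv:
  assumes g: "generator_graph P f h" and s: "s \<ge> 0"
  shows "has_unif_deriv (\<lambda>r. P r f) (P s h) s {0..}"
  unfolding has_unif_deriv_def
proof (intro allI impI)
  fix \<epsilon> :: real assume e: "\<epsilon> > 0"
  note c = generator_graph_continuous[OF g]
  have cont: "continuous_on {0..} (\<lambda>r. P r f x)" if "x \<in> SU2" for x
    unfolding continuous_on_def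
  proof
    fix r :: real assume "r \<in> {0..}"
    then show "((\<lambda>r. P r f x) \<longlongrightarrow> P r f x) (at r within {0..})"
      using tendsto_uniform_limitI[OF P_strongly_continuous[OF _ c(1)] that] by simp
  qed
  have right: "((\<lambda>q. (P (r + q) f x - P r f x) / q) \<longlongrightarrow> P r h x) (at_right 0)"
    if x: "x \<in> SU2" and r: "r \<ge> 0" for x r
  proof -
    have "((\<lambda>q. (P q (P r f) x - P r f x) / q) \<longlongrightarrow> P r h x) (at_right 0)"
      using generator_graph_P[OF g r] tendsto_uniform_limitI[OF _ x] unfolding generator_graph_def by blast
    moreover have "\<forall>\<^sub>F q in at_right 0. (P q (P r f) x - P r f x) / q = (P (r + q) f x - P r f x) / q"
      using eventually_at_right_less[of "0::real"]
    proof eventually_elim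
      fix q :: real assume "0 < q"
      then show "(P q (P r f) x - P r f x) / q = (P (r + q) f x - P r f x) / q"
        using P_add[of q r f x] r x c by (simp add: add.commute)
    qed
    ultimately show ?thesis by (rule Lim_transform_eventually)
  qed
  have "\<forall>\<^sub>F r in at s within {0..}. \<forall>x\<in>SU2. dist (P r h x) (P s h x) < \<epsilon>"
    using P_strongly_continuous[OF s c(2)] e unfolding uniform_limit_iff by blast
  then obtain \<delta> where d: "\<delta> > 0"
    "\<And>r x. r \<in> {0..} \<Longrightarrow> r \<noteq> s \<Longrightarrow> dist r s < \<delta> \<Longrightarrow> x \<in> SU2 \<Longrightarrow> dist (P r h x) (P s h x) < \<epsilon>"
    unfolding eventually_at by blast
  have d': "\<bar>P r h x - P s h x\<bar> \<le> \<epsilon>" if "r \<ge> 0" "\<bar>r - s\<bar> < \<delta>" "x \<in> SU2" for r x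
    using d(2)[of r x] that e by (cases "r = s") (auto simp: dist_real_def)
  show "\<exists>\<delta>>0. \<forall>r\<in>{0..}. \<bar>r - s\<bar> < \<delta> \<longrightarrow>
      (\<forall>x\<in>SU2. \<bar>P r f x - P s f x - (r - s) * P s h x\<bar> \<le> \<epsilon> * \<bar>r - s\<bar>)"
  proof (intro exI conjI ballI impI)
    fix r x assume r: "r \<in> {0..}" "\<bar>r - s\<bar> < \<delta>" and x: "x \<in> SU2"
    show "\<bar>P r f x - P s f x - (r - s) * P s h x\<bar> \<le> \<epsilon> * \<bar>r - s\<bar>"
    proof (cases "s \<le> r")
      case True
      have "\<bar>P r f x - P s f x - (r - s) * P s h x\<bar> \<le> \<epsilon> * (r - s)"
        using s r True
        by (intro right_derivative_close_imp_increment_close[where d = "\<lambda>q. P q h x"] True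
            continuous_on_subset[OF cont] right d' x) auto
      then show ?thesis using True by simp
    next
      case False
      have "\<bar>P s f x - P r f x - (s - r) * P s h x\<bar> \<le> \<epsilon> * (s - r)"
        using s r False
        by (intro right_derivative_close_imp_increment_close[where d = "\<lambda>q. P q h x"]
            continuous_on_subset[OF cont] right d' x) auto
      moreover have "\<bar>P s f x - P r f x - (s - r) * P s h x\<bar> = \<bar>P r f x - P s f x - (r - s) * P s h x\<bar>"
        by (subst abs_minus_commute) (simp add: algebra_simps)
      ultimately show ?thesis using False by simp
    qed
  qed (rule d(1))
qed

text \<open>The integral \<open>G s\<close> of \<open>(P\<^sub>s f)(T x) (P\<^bsub>t-s\<^esub> k)(x)\<close> interpolates between the two sides.  Its
  derivative is the difference of two pairings that agree because the closure of the sublaplacian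
  is symmetric and commutes with \<open>T\<close>.\<close>

lemma P_symmetric:
  assumes T: "sublaplacian_symmetry T" and f: "generator_graph P f h" and k: "generator_graph P k w"
    and t: "t \<ge> 0"
  shows "(\<integral>x. P t f (T x) * k x \<partial>\<mu>) = (\<integral>x. f (T x) * P t k x \<partial>\<mu>)"
proof -
  have T1: "\<And>x. x \<in> SU2 \<Longrightarrow> T x \<in> SU2" and Tc: "continuous_on SU2 T"
    using T by (auto simp: sublaplacian_symmetry_def intro: continuous_on_linear)
  note c = generator_graph_continuous[OF f] generator_graph_continuous[OF k]
  have cP: "continuous_on SU2 (\<lambda>x. P s u (T x))" if "s \<ge> 0" "continuous_on SU2 u" for s u
    by (intro continuous_on_SU2_compose[OF P_continuous[OF that] Tc] T1)
  define G where "G s = (\<integral>x. P s f (T x) * P (t - s) k x \<partial>\<mu>)" for s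
  have "(G has_real_derivative 0) (at s within {0..t})" if s: "s \<in> {0..t}" for s
  proof -
    have u: "has_unif_deriv (\<lambda>r x. P r f (T x)) (\<lambda>x. P s h (T x)) s {0..t}"
      using s by (intro has_unif_deriv_compose[OF has_unif_deriv_subset[OF P_has_unif_deriv[OF f]]] T1) auto
    have v: "has_unif_deriv (\<lambda>r. P (t - r) k) (\<lambda>x. - P (t - s) w x) s {0..t}"
      using s by (intro has_unif_deriv_subset[OF has_unif_deriv_reflect[OF P_has_unif_deriv[OF k]]]) auto
    have cs: "continuous_on SU2 (\<lambda>x. P s f (T x))" "continuous_on SU2 (\<lambda>x. P s h (T x))"
      "continuous_on SU2 (P (t - s) k)" "continuous_on SU2 (\<lambda>x. - P (t - s) w x)"
      using s c by (auto intro!: cP P_continuous continuous_on_minus)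
    have "(G has_real_derivative
        (\<integral>x. P s h (T x) * P (t - s) k x + P s f (T x) * - P (t - s) w x \<partial>\<mu>)) (at s within {0..t})"
      unfolding G_def
    proof (rule has_unif_deriv_integral[OF has_unif_deriv_mult[OF u v cs] s])
      show "continuous_on SU2 (\<lambda>x. P r f (T x) * P (t - r) k x)" if "r \<in> {0..t}" for r
        using that c by (intro continuous_on_mult cP P_continuous) auto
    qed (intro continuous_intros cs)
    moreover have "(\<integral>x. P s h (T x) * P (t - s) k x + P s f (T x) * - P (t - s) w x \<partial>\<mu>) =
        (\<integral>x. P s h (T x) * P (t - s) k x \<partial>\<mu>) + (\<integral>x. P s f (T x) * - P (t - s) w x \<partial>\<mu>)"
      by (intro Bochner_Integration.integral_add continuous_integrable continuous_on_mult cs)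
    moreover have "(\<integral>x. P s h (T x) * P (t - s) k x \<partial>\<mu>) = (\<integral>x. P s f (T x) * P (t - s) w x \<partial>\<mu>)"
    proof (rule closure_graph_symmetric[OF T])
      show "sublaplacian_closure_graph (P s f) (P s h)"
        using generator_graph_P[OF f] s unfolding graph_iff by simp
      show "sublaplacian_closure_graph (P (t - s) k) (P (t - s) w)"
        using generator_graph_P[OF k] s unfolding graph_iff by simp
    qed
    ultimately show ?thesis by simp
  qed
  then have "\<exists>c. \<forall>s\<in>{0..t}. G s = c"
    by (intro has_field_derivative_zero_constant) auto
  then have "G 0 = G t" using t by auto
  moreover have "G 0 = (\<integral>x. f (T x) * P t k x \<partial>\<mu>)"
    unfolding G_def by (intro integral_cong_SU2) (simp add: P_0 c T1)
  moreover have "G t = (\<integral>x. P t f (T x) * k x \<partial>\<mu>)"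
    unfolding G_def by (intro integral_cong_SU2) (simp add: P_0 c T1)
  ultimately show ?thesis by simp
qed

text \<open>Tested against a smooth \<open>k\<close>, both sides equal the integral of \<open>f(T x) P\<^sub>t k(x)\<close>: the right-hand
  side by \<open>P_symmetric\<close> for \<open>T\<close>, the left-hand side by \<open>P_symmetric\<close> for the identity.\<close>

lemma P_commute_symmetry:
  assumes T: "sublaplacian_symmetry T" and f: "smooth_on_SU2 f" and t: "t \<ge> 0" and x: "x \<in> SU2"
  shows "P t (\<lambda>y. f (T y)) x = P t f (T x)"
proof -
  have T1: "linear T" "\<forall>x\<in>SU2. T x \<in> SU2"
    using T by (auto simp: sublaplacian_symmetry_def)
  have sT: "smooth_on_SU2 (\<lambda>x. u (T x))" if "smooth_on_SU2 u" for u
    using T1(2) by (intro smooth_on_SU2_compose_linear[OF T1(1) _ that]) blast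
  note fT = sT[OF f]
  have c: "continuous_on SU2 (P t (\<lambda>y. f (T y)))" "continuous_on SU2 (\<lambda>x. P t f (T x))"
    using P_continuous[OF t smooth_on_SU2_imp_continuous_on[OF fT]]
      continuous_on_SU2_compose[OF P_continuous[OF t smooth_on_SU2_imp_continuous_on[OF f]]
        continuous_on_linear[OF T1(1)]] T1(2)
    by blast+
  show ?thesis
  proof (rule eq_on_SU2_if_smooth_tests_agree[OF c _ x])
    fix k assume k: "smooth_on_SU2 k"
    show "(\<integral>x. P t (\<lambda>y. f (T y)) x * k x \<partial>\<mu>) = (\<integral>x. P t f (T x) * k x \<partial>\<mu>)"
      using P_symmetric[OF T smooth_generator_graph[OF f] smooth_generator_graph[OF k] t]
        P_symmetric[OF sublaplacian_symmetry_id smooth_generator_graph[OF fT] smooth_generator_graph[OF k] t]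
      by simp
  qed
qed

end

section \<open>Symmetries of the sublaplacian\<close>

lemma field_left_translate:
  assumes E: "E \<in> {eX, eY}"
  shows "left_inv_field E (\<lambda>y. \<phi> (a ** y)) = (\<lambda>x. left_inv_field E \<phi> (a ** x))"
  unfolding field_eq_rot[OF E, abs_def] by (simp add: matrix_mul_assoc)

lemma sublaplacian_symmetry_left_translate:
  assumes "a \<in> SU2" shows "sublaplacian_symmetry (\<lambda>x. a ** x)"
proof -
  have "sublaplacian (\<lambda>y. \<phi> (a ** y)) x = sublaplacian \<phi> (a ** x)" for \<phi> x
    by (simp add: sublaplacian_def field_X_eq field_Y_eq field_left_translate)
  then show ?thesis
    using assms by (simp add: sublaplacian_symmetry_def linear_matrix_mult_left)
qed

text \<open>Conjugation by \<open>diag (e\<^bsup>i\<theta>\<^esup>, e\<^bsup>-i\<theta>\<^esup>)\<close> rotates the plane spanned by the two generators by the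
  angle \<open>2 \<theta>\<close>; with \<open>\<theta> = \<pi>/4\<close> it permutes them up to sign.\<close>

definition quarter :: cmat2 where
  "quarter = vector [vector [cis (pi / 4), 0], vector [0, cis (- pi / 4)]]"

lemma quarter_in_SU2: "quarter \<in> SU2"
  by (simp add: SU2_def quarter_def conj_transpose_def matrix_matrix_mult_def vec_eq_iff mat_def
      forall_2 sum_2 det_2 cis_cnj cis_mult)

lemma quarter_eX: "quarter ** eX = eY ** quarter"
  and quarter_eY: "quarter ** eY = - (eX ** quarter)"
proof -
  have c: "cis (pi / 4) = \<i> * cis (- (pi / 4))"
    using cis_mult[of "pi / 2" "- (pi / 4)"] by (simp add: cis_pi_half)
  have "\<i> * z * \<i> = - z" for z by (simp add: complex_eq_iff)
  with c show "quarter ** eX = eY ** quarter" "quarter ** eY = - (eX ** quarter)"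
    by (simp_all add: quarter_def eX_def eY_def matrix_matrix_mult_def vec_eq_iff forall_2 sum_2)
qed

definition quarter_turn :: "cmat2 \<Rightarrow> cmat2" where
  "quarter_turn x = quarter ** x ** conj_transpose quarter"

lemma quarter_turn_in_SU2: "x \<in> SU2 \<Longrightarrow> quarter_turn x \<in> SU2"
  unfolding quarter_turn_def by (intro SU2_mult SU2_conj_transpose quarter_in_SU2)

lemma linear_quarter_turn: "linear quarter_turn"
  unfolding quarter_turn_def[abs_def] by (rule linear_conjugation)

lemma quarter_turn_mult:
  assumes "quarter ** r = r' ** quarter"
  shows "quarter_turn (x ** r) = quarter_turn x ** r'"
proof -
  have q: "conj_transpose quarter ** quarter = mat 1" "quarter ** conj_transpose quarter = mat 1"
    using quarter_in_SU2 by (rule SU2_inverse_left SU2_inverse_right)+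
  have "r = conj_transpose quarter ** (r' ** quarter)"
    unfolding assms[symmetric] by (simp add: matrix_mul_assoc q)
  then have "r ** conj_transpose quarter = conj_transpose quarter ** r' ** (quarter ** conj_transpose quarter)"
    by (simp only: matrix_mul_assoc)
  then show ?thesis
    unfolding quarter_turn_def by (metis matrix_mul_assoc matrix_mul_rid q(2))
qed

lemma matrix_mult_diff_left: "(A - B) ** C = A ** C - B ** C" for A B C :: cmat2
  by (simp add: matrix_matrix_mult_def vec_eq_iff sum_subtractf left_diff_distrib)

lemma quarter_rot: 
  "quarter ** rot eX s = rot eY s ** quarter" "quarter ** rot eY s = rot eX (- s) ** quarter"
  by (simp_all add: rot_def matrix_add_ldistrib matrix_mult_add_left matrix_mult_diff_left
      matrix_mult_scaleR_left matrix_mult_scaleR_right quarter_eX quarter_eY)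

lemma field_cong:
  assumes E: "E \<in> {eX, eY}" and x: "x \<in> SU2" and eq: "\<And>y. y \<in> SU2 \<Longrightarrow> u y = v y"
  shows "left_inv_field E u x = left_inv_field E v x"
proof -
  have "(\<lambda>s. u (x ** rot E s)) = (\<lambda>s. v (x ** rot E s))"
    using eq[OF rot_SU2_mult[OF E x]] by (simp add: fun_eq_iff)
  then show ?thesis unfolding field_eq_rot[OF E] by simp
qed

lemma field_X_quarter_turn:
  "left_inv_field eX (\<lambda>y. \<phi> (quarter_turn y)) = (\<lambda>x. left_inv_field eY \<phi> (quarter_turn x))"
  using quarter_turn_mult[OF quarter_rot(1)] by (simp add: field_eq_rot fun_eq_iff)

lemma field_Y_quarter_turn:
  assumes \<phi>: "smooth_on_SU2 \<phi>" and x: "x \<in> SU2"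
  shows "left_inv_field eY (\<lambda>y. \<phi> (quarter_turn y)) x = - left_inv_field eX \<phi> (quarter_turn x)"
proof -
  have "((\<lambda>s. \<phi> (quarter_turn x ** rot eX s)) has_real_derivative left_inv_field eX \<phi> (quarter_turn x)) (at (- 0))"
    using has_derivative_along_rot[OF _ \<phi> quarter_turn_in_SU2[OF x], of eX 0] by simp
  then have "((\<lambda>s. \<phi> (quarter_turn x ** rot eX (- s))) has_real_derivative - left_inv_field eX \<phi> (quarter_turn x)) (at 0)"
    by (rule DERIV_mirror[THEN iffD1])
  then show ?thesis
    using quarter_turn_mult[OF quarter_rot(2), of x] by (simp add: field_eq_rot DERIV_imp_deriv)
qed

lemma field_minus:
  assumes E: "E \<in> {eX, eY}" and \<phi>: "smooth_on_SU2 \<phi>" and x: "x \<in> SU2"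
  shows "left_inv_field E (\<lambda>y. - \<phi> y) x = - left_inv_field E \<phi> x"
  unfolding field_eq_rot[OF E, of "\<lambda>y. - \<phi> y"]
  using DERIV_minus[OF has_derivative_along_rot[OF E \<phi> x, of 0]] by (intro DERIV_imp_deriv) simp

lemma smooth_on_SU2_minus: "smooth_on_SU2 f \<Longrightarrow> smooth_on_SU2 (\<lambda>x. - f x)"
  using smooth_on_SU2_diff[OF smooth_on_SU2_const[of 0], of f] by simp

text \<open>The quarter turn exchanges the two squares in the sublaplacian; the sign cancels.\<close>

lemma sublaplacian_symmetry_quarter_turn: "sublaplacian_symmetry quarter_turn"
  unfolding sublaplacian_symmetry_def
proof (intro conjI allI impI ballI linear_quarter_turn quarter_turn_in_SU2)
  fix \<phi> x assume \<phi>: "smooth_on_SU2 \<phi>" and x: "x \<in> SU2"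
  have X: "smooth_on_SU2 (left_inv_field eX \<phi>)" using \<phi> by (intro smooth_on_SU2_field) auto
  have "left_inv_field eY (left_inv_field eY (\<lambda>y. \<phi> (quarter_turn y))) x =
      left_inv_field eY (\<lambda>y. - left_inv_field eX \<phi> (quarter_turn y)) x"
    by (intro field_cong x field_Y_quarter_turn \<phi>) auto
  also have "\<dots> = - left_inv_field eX (\<lambda>y. - left_inv_field eX \<phi> y) (quarter_turn x)"
    by (rule field_Y_quarter_turn[OF smooth_on_SU2_minus[OF X] x])
  also have "\<dots> = left_inv_field eX (left_inv_field eX \<phi>) (quarter_turn x)"
    using field_minus[OF _ X quarter_turn_in_SU2[OF x], of eX] by simp
  finally show "sublaplacian (\<lambda>y. \<phi> (quarter_turn y)) x = sublaplacian \<phi> (quarter_turn x)"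
    by (simp add: sublaplacian_def field_X_eq field_Y_eq field_X_quarter_turn)
qed

section \<open>The heat kernel\<close>

lemma (in haar) continuous_on_integral_parameter:
  fixes H :: "cmat2 \<Rightarrow> cmat2 \<Rightarrow> real"
  assumes "continuous_on (SU2 \<times> SU2) (\<lambda>z. H (fst z) (snd z))"
  shows "continuous_on SU2 (\<lambda>x. \<integral>y. H x y \<partial>\<mu>)"
proof -
  have uc: "uniformly_continuous_on (SU2 \<times> SU2) (\<lambda>z. H (fst z) (snd z))"
    by (intro compact_uniformly_continuous assms compact_Times compact_SU2)
  have int: "integrable \<mu> (H x)" if "x \<in> SU2" for x
  proof (rule continuous_integrable)
    have "continuous_on SU2 (\<lambda>y. H (fst (x, y)) (snd (x, y)))"
      using that by (intro continuous_on_compose2[OF assms]) (auto intro: continuous_on_Pair continuous_on_id continuous_on_const)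
    then show "continuous_on SU2 (H x)" by simp
  qed
  show ?thesis
    unfolding continuous_on_iff
  proof (intro ballI allI impI)
    fix x :: cmat2 and e :: real assume x: "x \<in> SU2" and e: "e > 0"
    obtain d where d: "d > 0" "\<And>z z'. z \<in> SU2 \<times> SU2 \<Longrightarrow> z' \<in> SU2 \<times> SU2 \<Longrightarrow> dist z' z < d \<Longrightarrow>
        dist (H (fst z') (snd z')) (H (fst z) (snd z)) < e / 2"
      using uc e unfolding uniformly_continuous_on_def by (meson half_gt_zero)
    show "\<exists>d>0. \<forall>x'\<in>SU2. dist x' x < d \<longrightarrow> dist (\<integral>y. H x' y \<partial>\<mu>) (\<integral>y. H x y \<partial>\<mu>) < e"
    proof (intro exI conjI ballI impI)
      fix x' assume x': "x' \<in> SU2" "dist x' x < d"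
      have "(\<integral>y. H x' y \<partial>\<mu>) - (\<integral>y. H x y \<partial>\<mu>) = (\<integral>y. H x' y - H x y \<partial>\<mu>)"
        by (intro Bochner_Integration.integral_diff[symmetric] int x x')
      also have "\<bar>\<dots>\<bar> \<le> e / 2"
      proof (rule abs_integral_le)
        fix y assume "y \<in> SU2"
        then show "\<bar>H x' y - H x y\<bar> \<le> e / 2"
          using d(2)[of "(x, y)" "(x', y)"] x x' by (simp add: dist_Pair_Pair dist_real_def)
      qed (use e in simp)
      finally show "dist (\<integral>y. H x' y \<partial>\<mu>) (\<integral>y. H x y \<partial>\<mu>) < e"
        using e by (simp add: dist_real_def)
    qed (rule d(1))
  qed
qed

locale heat_kernel_SU2 = heat +
  fixes p :: "real \<Rightarrow> cmat2 \<Rightarrow> real"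
  assumes kernel: "heat_kernel \<mu> P p"
begin

lemma p_smooth: "t > 0 \<Longrightarrow> smooth_on_SU2 (p t)"
  using kernel unfolding heat_kernel_def by blast

lemma p_continuous: "t > 0 \<Longrightarrow> continuous_on SU2 (p t)"
  by (intro smooth_on_SU2_imp_continuous_on p_smooth)

lemma P_at_one: "t > 0 \<Longrightarrow> continuous_on SU2 f \<Longrightarrow> P t f (mat 1) = (\<integral>h. p t h * f h \<partial>\<mu>)"
  using kernel unfolding heat_kernel_def by blast

lemma P_eq_convolution:
  assumes t: "t > 0" and f: "smooth_on_SU2 f" and a: "a \<in> SU2"
  shows "P t f a = (\<integral>h. p t h * f (a ** h) \<partial>\<mu>)"
proof -
  have s: "smooth_on_SU2 (\<lambda>h. f (a ** h))"
    using a by (intro smooth_on_SU2_compose_linear[OF linear_matrix_mult_left _ f]) simp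
  have "P t f (a ** mat 1) = P t (\<lambda>h. f (a ** h)) (mat 1)"
    using P_commute_symmetry[OF sublaplacian_symmetry_left_translate[OF a] f _ SU2_one] t by simp
  also have "\<dots> = (\<integral>h. p t h * f (a ** h) \<partial>\<mu>)"
    by (rule P_at_one[OF t smooth_on_SU2_imp_continuous_on[OF s]])
  finally show ?thesis by simp
qed

text \<open>The quarter turn fixes the identity, where the kernel represents the value of \<open>P\<^sub>t f\<close>, and \<open>P\<^sub>t\<close>
  commutes with it.\<close>

lemma p_quarter_turn:
  assumes t: "t > 0" and x: "x \<in> SU2"
  shows "p t (quarter_turn x) = p t x"
proof (rule eq_on_SU2_if_smooth_tests_agree[OF _ _ _ x])
  have sT: "smooth_on_SU2 (\<lambda>y. u (quarter_turn y))" if "smooth_on_SU2 u" for u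
    by (rule smooth_on_SU2_compose_linear[OF linear_quarter_turn quarter_turn_in_SU2 that])
  show "continuous_on SU2 (\<lambda>x. p t (quarter_turn x))"
    by (intro smooth_on_SU2_imp_continuous_on sT p_smooth t)
  show "continuous_on SU2 (p t)" by (rule p_continuous[OF t])
  fix k assume k: "smooth_on_SU2 k"
  define f where "f x = k (conj_transpose quarter ** x ** quarter)" for x
  have f: "smooth_on_SU2 f"
    unfolding f_def[abs_def]
    by (rule smooth_on_SU2_compose_linear[OF linear_conjugation _ k])
      (intro SU2_mult SU2_conj_transpose quarter_in_SU2)
  have fk: "f (quarter_turn x) = k x" for x
  proof -
    have "conj_transpose quarter ** (quarter ** x ** conj_transpose quarter) ** quarter =
        (conj_transpose quarter ** quarter) ** x ** (conj_transpose quarter ** quarter)"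
      by (simp only: matrix_mul_assoc)
    then show ?thesis by (simp add: f_def quarter_turn_def SU2_inverse_left[OF quarter_in_SU2])
  qed
  have one: "quarter_turn (mat 1) = mat 1"
    by (simp add: quarter_turn_def SU2_inverse_right[OF quarter_in_SU2])
  have "(\<integral>x. p t (quarter_turn x) * k x \<partial>\<mu>) = (\<integral>x. p t (quarter_turn x) * f (quarter_turn x) \<partial>\<mu>)"
    by (simp add: fk)
  also have "\<dots> = (\<integral>x. p t x * f x \<partial>\<mu>)"
    unfolding quarter_turn_def
    by (rule integral_conjugate[OF quarter_in_SU2, of "\<lambda>x. p t x * f x"])
      (intro continuous_on_mult p_continuous t smooth_on_SU2_imp_continuous_on f)
  also have "\<dots> = P t f (mat 1)"
    by (rule P_at_one[OF t smooth_on_SU2_imp_continuous_on[OF f], symmetric])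
  also have "\<dots> = P t (\<lambda>x. f (quarter_turn x)) (mat 1)"
    using P_commute_symmetry[OF sublaplacian_symmetry_quarter_turn f _ SU2_one, of t] t one by simp
  also have "\<dots> = (\<integral>x. p t x * k x \<partial>\<mu>)"
    unfolding fk by (rule P_at_one[OF t smooth_on_SU2_imp_continuous_on[OF k]])
  finally show "(\<integral>x. p t (quarter_turn x) * k x \<partial>\<mu>) = (\<integral>x. p t x * k x \<partial>\<mu>)" .
qed

text \<open>Write the symmetry of \<open>P\<^sub>t\<close> in terms of the kernel: the integral of \<open>P\<^sub>t f k\<close> is the double integral
  of \<open>p\<^sub>t(h) f(g h) k(g)\<close>, and the substitution \<open>g \<rightarrow> g h\<^sup>-\<^sup>1\<close> turns it into the pairing of \<open>f\<close> with
  \<open>g \<mapsto> \<integral> p\<^sub>t(h) k(g h\<^sup>-\<^sup>1) dh\<close>.  Hence this function is \<open>P\<^sub>t k\<close>; at the identity this says that \<open>p\<^sub>t\<close> and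
  its reflection have the same integral against \<open>k\<close>.\<close>

lemma p_inverse:
  assumes t: "t > 0" and x: "x \<in> SU2"
  shows "p t (conj_transpose x) = p t x"
proof (rule eq_on_SU2_if_smooth_tests_agree[OF _ _ _ x])
  note cp = p_continuous[OF t]
  show "continuous_on SU2 (p t)" by (rule cp)
  have ci: "continuous_on SU2 (\<lambda>x. u (conj_transpose x))" if "continuous_on SU2 u" for u :: "cmat2 \<Rightarrow> real"
    by (rule continuous_on_SU2_compose[OF that]) (auto intro: continuous_on_conj_transpose continuous_on_id)
  show "continuous_on SU2 (\<lambda>x. p t (conj_transpose x))" by (rule ci[OF cp])
  fix k assume k: "smooth_on_SU2 k"
  note ck = smooth_on_SU2_imp_continuous_on[OF k]
  have cH: "continuous_on (SU2 \<times> SU2) (\<lambda>z. p t (snd z) * k (fst z ** conj_transpose (snd z)))"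
  proof (rule continuous_on_mult)
    show "continuous_on (SU2 \<times> SU2) (\<lambda>z. p t (snd z))"
      by (rule continuous_on_compose2[OF cp]) (auto intro: continuous_on_snd continuous_on_id)
    show "continuous_on (SU2 \<times> SU2) (\<lambda>z. k (fst z ** conj_transpose (snd z)))"
    proof (rule continuous_on_compose2[OF ck])
      show "continuous_on (SU2 \<times> SU2) (\<lambda>z. fst z ** conj_transpose (snd z))"
        by (intro continuous_on_matrix_mult continuous_on_conj_transpose continuous_on_fst
            continuous_on_snd continuous_on_id)
    qed auto
  qed
  let ?v = "\<lambda>g. \<integral>h. p t h * k (g ** conj_transpose h) \<partial>\<mu>"
  have cv: "continuous_on SU2 ?v"
    by (rule continuous_on_integral_parameter[OF cH])
  have "?v (mat 1) = P t k (mat 1)"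
  proof (rule eq_on_SU2_if_smooth_tests_agree[OF cv _ _ SU2_one])
    show "continuous_on SU2 (P t k)" using t by (intro P_continuous ck) simp
    fix f assume f: "smooth_on_SU2 f"
    note cf = smooth_on_SU2_imp_continuous_on[OF f]
    have c1: "continuous_on (SU2 \<times> SU2) (\<lambda>z. f (fst z) * (p t (snd z) * k (fst z ** conj_transpose (snd z))))"
      by (intro continuous_on_mult cH continuous_on_compose2[OF cf] continuous_on_fst continuous_on_id) auto
    have c2: "continuous_on (SU2 \<times> SU2) (\<lambda>z. p t (snd z) * f (fst z ** snd z) * k (fst z))"
    proof (intro continuous_on_mult)
      show "continuous_on (SU2 \<times> SU2) (\<lambda>z. p t (snd z))"
        by (rule continuous_on_compose2[OF cp]) (auto intro: continuous_on_snd continuous_on_id)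
      show "continuous_on (SU2 \<times> SU2) (\<lambda>z. f (fst z ** snd z))"
      proof (rule continuous_on_compose2[OF cf])
        show "continuous_on (SU2 \<times> SU2) (\<lambda>z. fst z ** snd z)"
          by (intro continuous_on_matrix_mult continuous_on_fst continuous_on_snd continuous_on_id)
      qed auto
      show "continuous_on (SU2 \<times> SU2) (\<lambda>z. k (fst z))"
        by (rule continuous_on_compose2[OF ck]) (auto intro: continuous_on_fst continuous_on_id)
    qed
    have "(\<integral>g. ?v g * f g \<partial>\<mu>) = (\<integral>g. (\<integral>h. f g * (p t h * k (g ** conj_transpose h)) \<partial>\<mu>) \<partial>\<mu>)"
      by (simp add: mult.commute)
    also have "\<dots> = (\<integral>h. (\<integral>g. f g * (p t h * k (g ** conj_transpose h)) \<partial>\<mu>) \<partial>\<mu>)"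
      by (rule integral_swap[OF c1])
    also have "\<dots> = (\<integral>h. (\<integral>g. p t h * f (g ** h) * k g \<partial>\<mu>) \<partial>\<mu>)"
    proof (rule integral_cong_SU2)
      fix h assume h: "h \<in> SU2"
      have "continuous_on SU2 (\<lambda>g. f g * (p t h * k (g ** conj_transpose h)))"
      proof -
        have "continuous_on SU2 (\<lambda>g. (g, h))"
          by (intro continuous_on_Pair continuous_on_id continuous_on_const)
        moreover have "(\<lambda>g. (g, h)) ` SU2 \<subseteq> SU2 \<times> SU2" using h by auto
        ultimately show ?thesis using continuous_on_compose2[OF c1] by fastforce
      qed
      from integral_right_translate[OF h this, symmetric]
      show "(\<integral>g. f g * (p t h * k (g ** conj_transpose h)) \<partial>\<mu>) = (\<integral>g. p t h * f (g ** h) * k g \<partial>\<mu>)"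
        unfolding matrix_mul_assoc[symmetric] SU2_inverse_right[OF h] matrix_mul_rid
        by (simp add: mult.assoc mult.left_commute)
    qed
    also have "\<dots> = (\<integral>g. (\<integral>h. p t h * f (g ** h) * k g \<partial>\<mu>) \<partial>\<mu>)"
      by (rule integral_swap[OF c2, symmetric])
    also have "\<dots> = (\<integral>g. P t f g * k g \<partial>\<mu>)"
      by (intro integral_cong_SU2) (simp add: P_eq_convolution[OF t f])
    also have "\<dots> = (\<integral>g. f g * P t k g \<partial>\<mu>)"
      using P_symmetric[OF sublaplacian_symmetry_id smooth_generator_graph[OF f] smooth_generator_graph[OF k], of t] t
      by simp
    finally show "(\<integral>g. ?v g * f g \<partial>\<mu>) = (\<integral>g. P t k g * f g \<partial>\<mu>)" by (simp add: mult.commute)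
  qed
  moreover have "(\<integral>x. p t (conj_transpose x) * k x \<partial>\<mu>) = ?v (mat 1)"
    using integral_inverse[OF continuous_on_mult[OF cp ci[OF ck]]] by simp
  ultimately show "(\<integral>x. p t (conj_transpose x) * k x \<partial>\<mu>) = (\<integral>x. p t x * k x \<partial>\<mu>)"
    using P_at_one[OF t ck] by simp
qed

text \<open>Against \<open>k\<close>, both sides integrate to the value of \<open>P\<^sub>t (P\<^sub>s k)\<close> at the identity; on the right-hand
  side this uses the symmetry of \<open>P\<^sub>s\<close>.\<close>

lemma p_semigroup:
  assumes s: "s \<ge> 0" and t: "t > 0" and x: "x \<in> SU2"
  shows "p (t + s) x = P s (p t) x"
proof (rule eq_on_SU2_if_smooth_tests_agree[OF _ _ _ x])
  show "continuous_on SU2 (p (t + s))" using s t by (intro p_continuous) simp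
  show "continuous_on SU2 (P s (p t))" by (intro P_continuous s p_continuous t)
  fix k assume k: "smooth_on_SU2 k"
  note ck = smooth_on_SU2_imp_continuous_on[OF k]
  have "(\<integral>x. p (t + s) x * k x \<partial>\<mu>) = P (t + s) k (mat 1)"
    using s t by (intro P_at_one[symmetric] ck) simp
  also have "\<dots> = P t (P s k) (mat 1)" using s t by (intro P_add ck SU2_one) simp_all
  also have "\<dots> = (\<integral>x. p t x * P s k x \<partial>\<mu>)" by (intro P_at_one t P_continuous s ck)
  also have "\<dots> = (\<integral>x. P s (p t) x * k x \<partial>\<mu>)"
    by (rule P_symmetric[OF sublaplacian_symmetry_id smooth_generator_graph[OF p_smooth[OF t]]
          smooth_generator_graph[OF k] s, symmetric])
  finally show "(\<integral>x. p (t + s) x * k x \<partial>\<mu>) = (\<integral>x. P s (p t) x * k x \<partial>\<mu>)" .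
qed

text \<open>For times larger than \<open>\<tau> = t / 2\<close> the kernel is the orbit of the smooth function \<open>p\<^sub>\<tau>\<close> under the
  semigroup, which makes a two-sided derivative at \<open>t\<close> available.  The semigroup gives it as
  \<open>P\<^sub>\<tau> L p\<^sub>\<tau>\<close>; symmetry of \<open>L\<close> identifies this with \<open>L p\<^sub>t\<close>.\<close>

lemma p_has_unif_deriv:
  assumes t: "t > 0"
  shows "has_unif_deriv p (sublaplacian (p t)) t {t / 2<..}"
proof -
  define \<tau> where "\<tau> = t / 2"
  have \<tau>: "\<tau> > 0" "t - \<tau> = \<tau>" "\<tau> < t" using t by (auto simp: \<tau>_def field_simps)
  let ?h = "P \<tau> (sublaplacian (p \<tau>))"
  have gen: "generator_graph P (p \<tau>) (sublaplacian (p \<tau>))"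
    by (rule smooth_generator_graph[OF p_smooth[OF \<tau>(1)]])
  have eq: "?h x = sublaplacian (p t) x" if x: "x \<in> SU2" for x
  proof (rule eq_on_SU2_if_smooth_tests_agree[OF _ _ _ x])
    have g: "generator_graph P (P \<tau> (p \<tau>)) ?h" using \<tau> by (intro generator_graph_P gen) simp
    show "continuous_on SU2 ?h" by (rule generator_graph_continuous[OF g])
    show "continuous_on SU2 (sublaplacian (p t))"
      by (intro smooth_on_SU2_imp_continuous_on smooth_on_SU2_sublaplacian p_smooth t)
    fix k assume k: "smooth_on_SU2 k"
    have "(\<integral>x. ?h x * k x \<partial>\<mu>) = (\<integral>x. P \<tau> (p \<tau>) x * sublaplacian k x \<partial>\<mu>)"
      using closure_graph_symmetric[OF sublaplacian_symmetry_id] g smooth_imp_closure_graph[OF k]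
      unfolding graph_iff by blast
    also have "\<dots> = (\<integral>x. p t x * sublaplacian k x \<partial>\<mu>)"
      using p_semigroup[of \<tau> \<tau>] \<tau> by (intro integral_cong_SU2) (simp add: \<tau>_def)
    also have "\<dots> = (\<integral>x. sublaplacian (p t) x * k x \<partial>\<mu>)"
      by (rule integral_sublaplacian_symmetric[OF p_smooth[OF t] k, symmetric])
    finally show "(\<integral>x. ?h x * k x \<partial>\<mu>) = (\<integral>x. sublaplacian (p t) x * k x \<partial>\<mu>)" .
  qed
  have "has_unif_deriv (\<lambda>r. P r (p \<tau>)) ?h \<tau> {0..}"
    using \<tau> by (intro P_has_unif_deriv gen) simp
  then have D: "\<And>\<epsilon>. \<epsilon> > 0 \<Longrightarrow> \<exists>\<delta>>0. \<forall>r\<in>{0..}. \<bar>r - \<tau>\<bar> < \<delta> \<longrightarrow>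
      (\<forall>x\<in>SU2. \<bar>P r (p \<tau>) x - P \<tau> (p \<tau>) x - (r - \<tau>) * ?h x\<bar> \<le> \<epsilon> * \<bar>r - \<tau>\<bar>)"
    unfolding has_unif_deriv_def by blast
  show ?thesis
    unfolding has_unif_deriv_def
  proof (intro allI impI)
    fix \<epsilon> :: real assume "\<epsilon> > 0"
    from D[OF this] obtain \<delta> where d: "\<delta> > 0" "\<And>r x. r \<ge> 0 \<Longrightarrow> \<bar>r - \<tau>\<bar> < \<delta> \<Longrightarrow> x \<in> SU2 \<Longrightarrow>
        \<bar>P r (p \<tau>) x - P \<tau> (p \<tau>) x - (r - \<tau>) * ?h x\<bar> \<le> \<epsilon> * \<bar>r - \<tau>\<bar>"
      by (metis atLeast_iff)
    show "\<exists>\<delta>>0. \<forall>r\<in>{t / 2<..}. \<bar>r - t\<bar> < \<delta> \<longrightarrow>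
        (\<forall>x\<in>SU2. \<bar>p r x - p t x - (r - t) * sublaplacian (p t) x\<bar> \<le> \<epsilon> * \<bar>r - t\<bar>)"
    proof (intro exI conjI ballI impI)
      fix r x assume r: "r \<in> {t / 2<..}" "\<bar>r - t\<bar> < \<delta>" and x: "x \<in> SU2"
      have e: "(r - \<tau>) - \<tau> = r - t" by (simp add: \<tau>_def)
      have "p r x = P (r - \<tau>) (p \<tau>) x" "p t x = P \<tau> (p \<tau>) x"
        using p_semigroup[of "r - \<tau>" \<tau> x] p_semigroup[of \<tau> \<tau> x] r \<tau> x by (auto simp: \<tau>_def)
      then show "\<bar>p r x - p t x - (r - t) * sublaplacian (p t) x\<bar> \<le> \<epsilon> * \<bar>r - t\<bar>"
        using d(2)[of "r - \<tau>" x] r x eq[OF x] unfolding e by (simp add: \<tau>_def)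
    qed (rule d(1))
  qed
qed

lemma A_const_eq_energy:
  assumes t: "t > 0"
  shows "A_const \<mu> p t = (\<integral>x. carre_du_champ (p t) (p t) x \<partial>\<mu>) / 2"
proof -
  have t': "t \<in> {t / 2<..}" using t by simp
  note cp = p_continuous[OF t]
  have cL: "continuous_on SU2 (sublaplacian (p t))"
    by (intro smooth_on_SU2_imp_continuous_on smooth_on_SU2_sublaplacian p_smooth t)
  note D = p_has_unif_deriv[OF t]
  have "((\<lambda>s. \<integral>x. p s x * p s x \<partial>\<mu>) has_real_derivative
      (\<integral>x. sublaplacian (p t) x * p t x + p t x * sublaplacian (p t) x \<partial>\<mu>)) (at t within {t / 2<..})"
  proof (rule has_unif_deriv_integral[OF has_unif_deriv_mult[OF D D cp cL cp cL] t'])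
    show "continuous_on SU2 (\<lambda>x. p r x * p r x)" if "r \<in> {t / 2<..}" for r
      using that t by (intro continuous_on_mult p_continuous) auto
  qed (intro continuous_intros cp cL)
  moreover have "(\<integral>x. sublaplacian (p t) x * p t x + p t x * sublaplacian (p t) x \<partial>\<mu>) =
      - 2 * (\<integral>x. carre_du_champ (p t) (p t) x \<partial>\<mu>)"
  proof -
    have "(\<integral>x. sublaplacian (p t) x * p t x + p t x * sublaplacian (p t) x \<partial>\<mu>) =
        (\<integral>x. 2 * (sublaplacian (p t) x * p t x) \<partial>\<mu>)"
      by (simp add: mult.commute)
    also have "\<dots> = 2 * (\<integral>x. sublaplacian (p t) x * p t x \<partial>\<mu>)" by simp
    finally show ?thesis using integral_sublaplacian_mult[OF p_smooth[OF t] p_smooth[OF t]] by simp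
  qed
  ultimately have "((\<lambda>s. \<integral>x. (p s x)\<^sup>2 \<partial>\<mu>) has_real_derivative
      - 2 * (\<integral>x. carre_du_champ (p t) (p t) x \<partial>\<mu>)) (at t)"
    using at_within_open[OF t' open_greaterThan] by (simp add: power2_eq_square)
  then have "deriv (\<lambda>s. \<integral>x. (p s x)\<^sup>2 \<partial>\<mu>) t = - 2 * (\<integral>x. carre_du_champ (p t) (p t) x \<partial>\<mu>)"
    by (rule DERIV_imp_deriv)
  then show ?thesis by (simp add: A_const_def)
qed

text \<open>After the substitution \<open>h \<rightarrow> exp (-s E) h\<close> the parameter \<open>s\<close> occurs only in the kernel, on its left
  side; inverting its argument moves it to the right side, where the left-invariant field \<open>E\<close> acts.\<close>

lemma field_P_eq:
  assumes t: "t > 0" and E: "E \<in> {eX, eY}" and f: "smooth_on_SU2 f" and g: "g \<in> SU2"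
  shows "left_inv_field E (P t f) g =
    (\<integral>h. left_inv_field E (p t) (conj_transpose h) * (f (g ** h) - m) \<partial>\<mu>)"
proof -
  note cp = p_continuous[OF t] and cf = smooth_on_SU2_imp_continuous_on[OF f]
  have ci: "continuous_on SU2 (\<lambda>x. u (conj_transpose x))" if "continuous_on SU2 u" for u :: "cmat2 \<Rightarrow> real"
    by (rule continuous_on_SU2_compose[OF that]) (auto intro: continuous_on_conj_transpose continuous_on_id)
  have cfg: "continuous_on SU2 (\<lambda>h. f (g ** h))"
    using g by (intro continuous_on_SU2_compose[OF cf] continuous_on_linear linear_matrix_mult_left) simp
  have cE: "continuous_on SU2 (left_inv_field E (p t))"
    by (rule field_continuous[OF E p_smooth[OF t]])
  have cr: "continuous_on SU2 (\<lambda>x. p t (x ** rot E s))" for s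
    using rot_SU2_mult[OF E] by (intro continuous_on_SU2_compose[OF cp] continuous_on_linear linear_matrix_mult_right)
  have eq: "P t f (g ** rot E s) = (\<integral>h. p t (conj_transpose h ** rot E s) * f (g ** h) \<partial>\<mu>)" for s
  proof -
    let ?R = "rot E s"
    have R: "?R \<in> SU2" by (rule rot_in_SU2[OF E])
    have c: "continuous_on SU2 (\<lambda>h. p t (conj_transpose ?R ** h) * f (g ** h))"
      using R by (intro continuous_on_mult cfg continuous_on_SU2_compose[OF cp] continuous_on_linear linear_matrix_mult_left) simp
    have "P t f (g ** ?R) = (\<integral>h. p t h * f (g ** ?R ** h) \<partial>\<mu>)"
      using g R by (intro P_eq_convolution t f) simp
    also have "\<dots> = (\<integral>h. p t (conj_transpose ?R ** (?R ** h)) * f (g ** (?R ** h)) \<partial>\<mu>)"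
      unfolding SU2_cancel_left[OF R] by (simp only: matrix_mul_assoc)
    also have "\<dots> = (\<integral>h. p t (conj_transpose ?R ** h) * f (g ** h) \<partial>\<mu>)"
      by (rule integral_left_translate[OF R c])
    also have "\<dots> = (\<integral>h. p t (conj_transpose h ** ?R) * f (g ** h) \<partial>\<mu>)"
    proof (rule integral_cong_SU2)
      fix h assume h: "h \<in> SU2"
      have "p t (conj_transpose (conj_transpose ?R ** h)) = p t (conj_transpose ?R ** h)"
        using R h by (intro p_inverse t) simp
      then show "p t (conj_transpose ?R ** h) * f (g ** h) = p t (conj_transpose h ** ?R) * f (g ** h)"
        by (simp add: conj_transpose_mult)
    qed
    finally show ?thesis .
  qed
  have D: "has_unif_deriv (\<lambda>s h. p t (conj_transpose h ** rot E s)) (\<lambda>h. left_inv_field E (p t) (conj_transpose h)) 0 UNIV"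
    using has_unif_deriv_compose[OF has_unif_deriv_along_rot[OF E p_smooth[OF t]] SU2_conj_transpose] by simp
  have "((\<lambda>s. \<integral>h. p t (conj_transpose h ** rot E s) * f (g ** h) \<partial>\<mu>) has_real_derivative
      (\<integral>h. left_inv_field E (p t) (conj_transpose h) * f (g ** h) + p t (conj_transpose h ** rot E 0) * 0 \<partial>\<mu>)) (at 0 within UNIV)"
    by (intro has_unif_deriv_integral[OF has_unif_deriv_mult[OF D has_unif_deriv_const]]
        continuous_on_add continuous_on_mult ci[OF cE] ci[OF cr] cfg continuous_on_const UNIV_I)
  then have "((\<lambda>s. P t f (g ** rot E s)) has_real_derivative
      (\<integral>h. left_inv_field E (p t) (conj_transpose h) * f (g ** h) \<partial>\<mu>)) (at 0)"
    by (simp add: eq)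
  then have 1: "left_inv_field E (P t f) g = (\<integral>h. left_inv_field E (p t) (conj_transpose h) * f (g ** h) \<partial>\<mu>)"
    unfolding field_eq_rot[OF E, of "P t f"] by (rule DERIV_imp_deriv)
  have "(\<integral>h. left_inv_field E (p t) (conj_transpose h) \<partial>\<mu>) = 0"
    using integral_inverse[OF cE] integral_field_eq_0[OF E p_smooth[OF t]] by simp
  moreover have "(\<integral>h. left_inv_field E (p t) (conj_transpose h) * (f (g ** h) - m) \<partial>\<mu>) =
      (\<integral>h. left_inv_field E (p t) (conj_transpose h) * f (g ** h) \<partial>\<mu>) -
      (\<integral>h. left_inv_field E (p t) (conj_transpose h) * m \<partial>\<mu>)"
    unfolding right_diff_distrib
    by (intro Bochner_Integration.integral_diff continuous_integrable continuous_on_mult ci[OF cE] cfg continuous_on_const)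
  ultimately show ?thesis using 1 by simp
qed

text \<open>Since \<open>p\<^sub>t\<close> is invariant under the quarter turn \<open>c\<close>, one has \<open>X p\<^sub>t = (Y p\<^sub>t) \<circ> c\<close> and
  \<open>Y p\<^sub>t = - (X p\<^sub>t) \<circ> c\<close>, and \<open>c\<close> preserves Haar measure.  The second moments of the pair are therefore
  invariant under \<open>(X, Y) \<mapsto> (Y, - X)\<close>.\<close>

lemma field_p_second_moments:
  assumes t: "t > 0"
  defines "X \<equiv> left_inv_field eX (p t)" and "Y \<equiv> left_inv_field eY (p t)"
  shows "(\<integral>x. (X x)\<^sup>2 \<partial>\<mu>) = (\<integral>x. (Y x)\<^sup>2 \<partial>\<mu>)" and "(\<integral>x. X x * Y x \<partial>\<mu>) = 0"
proof -
  note sp = p_smooth[OF t]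
  have c: "continuous_on SU2 X" "continuous_on SU2 Y"
    unfolding X_def Y_def by (auto intro: field_continuous sp)
  have inv: "p t (quarter_turn y) = p t y" if "y \<in> SU2" for y by (rule p_quarter_turn[OF t that])
  have XY: "X x = Y (quarter_turn x)" if x: "x \<in> SU2" for x
  proof -
    have "left_inv_field eX (p t) x = left_inv_field eX (\<lambda>y. p t (quarter_turn y)) x"
      by (rule field_cong[OF _ x]) (simp_all add: inv)
    then show ?thesis by (simp add: X_def Y_def field_X_quarter_turn)
  qed
  have YX: "Y x = - X (quarter_turn x)" if x: "x \<in> SU2" for x
  proof -
    have "left_inv_field eY (p t) x = left_inv_field eY (\<lambda>y. p t (quarter_turn y)) x"
      by (rule field_cong[OF _ x]) (simp_all add: inv)
    then show ?thesis using field_Y_quarter_turn[OF sp x] by (simp add: X_def Y_def)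
  qed
  have turn: "(\<integral>x. u (quarter_turn x) \<partial>\<mu>) = integral\<^sup>L \<mu> u" if "continuous_on SU2 u" for u :: "cmat2 \<Rightarrow> real"
    unfolding quarter_turn_def by (rule integral_conjugate[OF quarter_in_SU2 that])
  have "(\<integral>x. (X x)\<^sup>2 \<partial>\<mu>) = (\<integral>x. (Y (quarter_turn x))\<^sup>2 \<partial>\<mu>)"
    by (intro integral_cong_SU2) (simp add: XY)
  also have "\<dots> = (\<integral>x. (Y x)\<^sup>2 \<partial>\<mu>)" by (intro turn continuous_on_power c)
  finally show "(\<integral>x. (X x)\<^sup>2 \<partial>\<mu>) = (\<integral>x. (Y x)\<^sup>2 \<partial>\<mu>)" .
  have "(\<integral>x. X x * Y x \<partial>\<mu>) = (\<integral>x. - (X (quarter_turn x) * Y (quarter_turn x)) \<partial>\<mu>)"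
    by (intro integral_cong_SU2) (simp add: XY YX mult.commute)
  also have "\<dots> = - (\<integral>x. X x * Y x \<partial>\<mu>)"
    using turn[OF continuous_on_mult[OF c]] by simp
  finally show "(\<integral>x. X x * Y x \<partial>\<mu>) = 0" by simp
qed

text \<open>The integral of \<open>(a X' + b Y' - c F)\<^sup>2\<close> is nonnegative for all \<open>c\<close>.  The choice of the components \<open>a\<close>
  and \<open>b\<close> of the gradient as coefficients makes it the quadratic polynomial \<open>N M - 2 c N + c\<^sup>2 V\<close>,
  where \<open>N\<close> is the left-hand side of the bound and \<open>V\<close> the variance.\<close>

lemma gradient_bound:
  assumes f: "smooth_on_SU2 f" and t: "t > 0" and g: "g \<in> SU2"
  shows "carre_du_champ (P t f) (P t f) g \<le> A_const \<mu> p t * ((\<integral>h. (f h)\<^sup>2 \<partial>\<mu>) - (\<integral>h. f h \<partial>\<mu>)\<^sup>2)"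
proof -
  define m where "m = (\<integral>h. f h \<partial>\<mu>)"
  define F where "F h = f (g ** h) - m" for h
  define X where "X = left_inv_field eX (p t)"
  define Y where "Y = left_inv_field eY (p t)"
  define X' where "X' h = X (conj_transpose h)" for h
  define Y' where "Y' h = Y (conj_transpose h)" for h
  define a where "a = left_inv_field eX (P t f) g"
  define b where "b = left_inv_field eY (P t f) g"
  define M where "M = (\<integral>x. (X x)\<^sup>2 \<partial>\<mu>)"
  define V where "V = (\<integral>h. (F h)\<^sup>2 \<partial>\<mu>)"
  note sp = p_smooth[OF t] and cf = smooth_on_SU2_imp_continuous_on[OF f]
  have ci: "continuous_on SU2 (\<lambda>x. u (conj_transpose x))" if "continuous_on SU2 u" for u :: "cmat2 \<Rightarrow> real"
    by (rule continuous_on_SU2_compose[OF that]) (auto intro: continuous_on_conj_transpose continuous_on_id)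
  have cX: "continuous_on SU2 X" and cY: "continuous_on SU2 Y"
    unfolding X_def Y_def by (auto intro: field_continuous sp)
  have cX': "continuous_on SU2 X'" and cY': "continuous_on SU2 Y'"
    unfolding X'_def[abs_def] Y'_def[abs_def] by (rule ci[OF cX], rule ci[OF cY])
  have cF: "continuous_on SU2 F"
    unfolding F_def[abs_def] using g
    by (intro continuous_on_diff continuous_on_const continuous_on_SU2_compose[OF cf] continuous_on_linear
        linear_matrix_mult_left) simp
  note int = continuous_integrable[OF continuous_on_mult]
  have XX: "(\<integral>h. X' h * X' h \<partial>\<mu>) = M"
    using integral_inverse[OF continuous_on_mult[OF cX cX]] by (simp add: X'_def M_def power2_eq_square)
  have YY: "(\<integral>h. Y' h * Y' h \<partial>\<mu>) = M"
    using integral_inverse[OF continuous_on_mult[OF cY cY]] field_p_second_moments(1)[OF t]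
    by (simp add: Y'_def M_def X_def Y_def power2_eq_square)
  have XY: "(\<integral>h. X' h * Y' h \<partial>\<mu>) = 0"
    using integral_inverse[OF continuous_on_mult[OF cX cY]] field_p_second_moments(2)[OF t]
    by (simp add: X'_def Y'_def X_def Y_def)
  have aF: "(\<integral>h. X' h * F h \<partial>\<mu>) = a"
    using field_P_eq[OF t _ f g, of eX m] by (simp add: a_def X'_def X_def F_def)
  have bF: "(\<integral>h. Y' h * F h \<partial>\<mu>) = b"
    using field_P_eq[OF t _ f g, of eY m] by (simp add: b_def Y'_def Y_def F_def)
  define N where "N = a\<^sup>2 + b\<^sup>2"
  have quad: "0 \<le> N * M - 2 * c * N + c\<^sup>2 * V" for c
  proof -
    have "0 \<le> (\<integral>h. (a * X' h + b * Y' h - c * F h)\<^sup>2 \<partial>\<mu>)" by simp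
    also have "\<dots> = (\<integral>h. a\<^sup>2 * (X' h * X' h) + b\<^sup>2 * (Y' h * Y' h) + c\<^sup>2 * (F h * F h) +
        2 * a * b * (X' h * Y' h) - 2 * a * c * (X' h * F h) - 2 * b * c * (Y' h * F h) \<partial>\<mu>)"
      by (rule arg_cong[where f = "integral\<^sup>L \<mu>"]) (auto simp: fun_eq_iff power2_eq_square algebra_simps)
    also have "\<dots> = a\<^sup>2 * M + b\<^sup>2 * M + c\<^sup>2 * V + 2 * a * b * 0 - 2 * a * c * a - 2 * b * c * b"
      using int[OF cX' cX'] int[OF cY' cY'] int[OF cF cF] int[OF cX' cY'] int[OF cX' cF] int[OF cY' cF]
      by (simp add: XX YY XY aF bF V_def power2_eq_square)
    also have "\<dots> = N * M - 2 * c * N + c\<^sup>2 * V" by (simp add: N_def power2_eq_square algebra_simps)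
    finally show ?thesis .
  qed
  have N0: "N \<ge> 0" by (simp add: N_def)
  have V0: "V \<ge> 0" by (simp add: V_def)
  have M0: "M \<ge> 0" by (simp add: M_def)
  have "N \<le> M * V"
  proof (cases "V = 0")
    case True
    \<comment> \<open>The polynomial is now linear in \<open>c\<close>, and any \<open>c\<close> beyond \<open>M / 2\<close> forces \<open>N = 0\<close>.\<close>
    then have "N * (M + 2) \<le> 0" using quad[of "M + 1"] by (simp add: algebra_simps)
    then have "N = 0" using N0 M0 by (auto simp: mult_le_0_iff)
    then show ?thesis using True by simp
  next
    case False
    then have V: "V > 0" using V0 by simp
    \<comment> \<open>\<open>c = N / V\<close> minimises the quadratic polynomial.\<close>
    have "0 \<le> N * M - N\<^sup>2 / V" using quad[of "N / V"] V by (simp add: power2_eq_square field_simps)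
    then have "N * N \<le> N * (M * V)" using V by (simp add: field_simps power2_eq_square)
    then show ?thesis using N0 M0 V by (cases "N = 0") auto
  qed
  moreover have "A_const \<mu> p t = M"
  proof -
    have "(\<integral>x. carre_du_champ (p t) (p t) x \<partial>\<mu>) = (\<integral>x. X x * X x \<partial>\<mu>) + (\<integral>x. Y x * Y x \<partial>\<mu>)"
      unfolding carre_du_champ_def field_X_eq field_Y_eq X_def[symmetric] Y_def[symmetric]
      by (intro Bochner_Integration.integral_add int cX cY)
    then show ?thesis
      using A_const_eq_energy[OF t] field_p_second_moments(1)[OF t]
      by (simp add: M_def X_def Y_def power2_eq_square)
  qed
  moreover have "V = (\<integral>h. (f h)\<^sup>2 \<partial>\<mu>) - (\<integral>h. f h \<partial>\<mu>)\<^sup>2"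
  proof -
    have "V = (\<integral>h. (f h - m)\<^sup>2 \<partial>\<mu>)"
      unfolding V_def F_def
      by (rule integral_left_translate[OF g]) (intro continuous_intros cf)
    also have "\<dots> = (\<integral>h. f h * f h - 2 * m * f h + m * m \<partial>\<mu>)"
      by (rule arg_cong[where f = "integral\<^sup>L \<mu>"]) (auto simp: fun_eq_iff power2_eq_square algebra_simps)
    also have "\<dots> = (\<integral>h. f h * f h \<partial>\<mu>) - 2 * m * m + m * m"
      using int[OF cf cf] continuous_integrable[OF cf] by (simp add: m_def)
    finally show ?thesis by (simp add: m_def power2_eq_square)
  qed
  moreover have "carre_du_champ (P t f) (P t f) g = N"
    by (simp add: carre_du_champ_def field_X_eq field_Y_eq N_def a_def b_def power2_eq_square)
  ultimately show ?thesis by simp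
qed

end

theorem proposition4p1:
  fixes \<mu> :: "cmat2 measure"
    and P :: "real \<Rightarrow> (cmat2 \<Rightarrow> real) \<Rightarrow> cmat2 \<Rightarrow> real"
    and p :: "real \<Rightarrow> cmat2 \<Rightarrow> real"
    and f :: "cmat2 \<Rightarrow> real" and t :: real and g :: cmat2
  assumes "haar_probability \<mu>"
    and "heat_semigroup P"
    and "heat_kernel \<mu> P p"
    and "smooth_on_SU2 f"
    and "t > 0" and "g \<in> SU2"
  shows "carre_du_champ (P t f) (P t f) g \<le>
    A_const \<mu> p t * ((\<integral>h. (f h)\<^sup>2 \<partial>\<mu>) - (\<integral>h. f h \<partial>\<mu>)\<^sup>2)"
proof -
  interpret heat_kernel_SU2 \<mu> P p
    by unfold_locales (rule assms)+
  show ?thesis by (rule gradient_bound[OF assms(4-6)])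
qed

end
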